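(* Let $m=1$, write $g=g_1$, let $\beta\in(0,1)$, and let $\{\epsilon_n\}\subset(0,\infty)$ satisfy $n\epsilon_n^2\ge 1$ for all $n\ge1$ and $\epsilon_n^2\to0$ as $n\to\infty$. Suppose that the loss functions $$L^1_n(\xi,\xi_0)=n\sup_{x\in\mathcal X}\left|\mathbb I_{(-\infty,0]}(g(x,\xi))-\mathbb I_{(-\infty,0]}(g(x,\xi_0))\right|,\qquad L^2_n(\xi,\xi_0)=n\sup_{x\in\mathcal X}|f(x,\xi)-f(x,\xi_0)|$$ both satisfy the test condition, that the prior satisfies the sieve-mass condition and the prior-mass condition, with $C>C_2+C_3+2$, that $f(\cdot,\xi)$ and $g(\cdot,\xi)$ are continuous on $\mathcal X$ for almost every $\xi\in\Theta$, and that $\mathcal X$ is compact. Then there exist fixed constants $M_1>0$ and $M_2>0$ such that for all $n\ge1$, any $\eta>0$ and any $\delta\in(0,\beta)$, $$P_0^n\left[\,|V^*_{B}(\mathbf X_n)-V^*|>2\eta\,\right]\le\left[\frac{M_1}{\min(\delta,1-\beta)}+\frac{M_2}{\eta}\right]\epsilon_n^2.$$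
   Context: Setting. $\mathcal X\subseteq\mathbb R^p$ is a convex decision set, $\Theta\subseteq\mathbb R^q$ a parameter set, $\xi_0\in\Theta$ the true parameter, and $f,g_i:\mathcal X\times\mathbb R^q\to\mathbb R$ ($i=1,\dots,m$) are cost and constraint functions. For each $n\ge1$, $\{P^n_\xi:\xi\in\Theta\}$ is a family of probability distributions on $\mathbb R^{d\times n}$ with densities $p^n_\xi$; the data $\mathbf X_n=(X_1,\dots,X_n)$ (not necessarily i.i.d.) are drawn from $P_0^n:=P^n_{\xi_0}$. $\Pi$ is a prior distribution on $\Theta$ with density $\pi$; the posterior density is $\pi(\xi|\mathbf X_n)=p^n_\xi(\mathbf X_n)\pi(\xi)/\int p^n_{\xi}(\mathbf X_n)\pi(\xi)d\xi$, and $\Pi(A|\mathbf X_n)=\int_A\pi(\xi|\mathbf X_n)d\xi$. $\mathbb I_A$ is the indicator function of a set $A$. Optimal values ($m=1$). $V^*$ is the optimal value of: minimize $f(x,\xi_0)$ over $x\in\mathcal X$ subject to $g(x,\xi_0)\le0$; this problem is assumed to have a solution. $V^*_{B}(\mathbf X_n)$ is the optimal value of: minimize $\mathbb E_{\pi(\xi|\mathbf X_n)}[f(x,\xi)]$ over $x\in\mathcal X$ subject to $\Pi(g(x,\xi)\le0\,|\,\mathbf X_n)\ge\beta$ (with value $+\infty$ if infeasible). Conditions, with positive constants $C,C_0,C_1,C_2,C_3$ not depending on $n$ or $\epsilon$. Test condition for a loss $L_n(\cdot,\cdot)\ge0$: for every $n\ge 1$ and every $\epsilon>\epsilon_n$ there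 exist a measurable function (test) $\phi_{n,\epsilon}$ of $\mathbf X_n$ with values in $[0,1]$ and a set (sieve) $\Theta_n(\epsilon)\subseteq\Theta$ such that (i) $\mathbb E_{P_0^n}[\phi_{n,\epsilon}]\le C_0\exp(-Cn\epsilon^2)$, and (ii) $\sup_{\{\xi\in\Theta_n(\epsilon):\,L_n(\xi,\xi_0)\ge C_1n\epsilon^2\}}\mathbb E_{P^n_\xi}[1-\phi_{n,\epsilon}]\le\exp(-Cn\epsilon^2)$. Sieve-mass condition: $\Pi(\Theta\setminus\Theta_n(\epsilon))\le\exp(-Cn\epsilon^2)$ for every $n\ge 1$ and $\epsilon>\epsilon_n$, for the sieves $\Theta_n(\epsilon)$ of the test condition. Prior-mass condition: for some fixed $\lambda>0$ and every $n\ge 1$, $\Pi(A_n)\ge\exp(-nC_2\epsilon_n^2)$, where $A_n=\{\xi\in\Theta:D_{1+\lambda}(P_0^n\|P^n_\xi)\le C_3n\epsilon_n^2\}$ and $D_{1+\lambda}(P_0^n\|P_\xi^n)=\frac1\lambda\log\int\left(\frac{dP_0^n}{dP_\xi^n}\right)^{\lambda}dP_0^n$ is the Rényi divergence ($P_0^n$ absolutely continuous with respect to $P_\xi^n$). *)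

theory Defs
  imports "HOL-Probability.Probability"
begin

text \<open>A point of $R^{d \times n}$ is an (extensional) family of $n$ columns in $R^d$, indexed by
  $1, \ldots, n$; densities are taken with respect to the Lebesgue measure.\<close>

definition data_lebesgue :: "nat \<Rightarrow> (nat \<Rightarrow> real^'d) measure" where
  "data_lebesgue n = (\<Pi>\<^sub>M i\<in>{1..n}. lborel)"

definition param_lebesgue :: "(real^'q) set \<Rightarrow> (real^'q) measure" where
  "param_lebesgue \<Theta> = restrict_space lborel \<Theta>"

definition law :: "(nat \<Rightarrow> real^'q \<Rightarrow> (nat \<Rightarrow> real^'d) \<Rightarrow> real) \<Rightarrow> nat \<Rightarrow> real^'q
    \<Rightarrow> (nat \<Rightarrow> real^'d) measure" where
  "law p n \<xi> = density (data_lebesgue n) (\<lambda>x. ennreal (p n \<xi> x))"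

text \<open>Joint measurability in parameter and data is the regularity needed for the posterior and its
  integrals against the data to be meaningful.\<close>

definition statistical_model ::
    "(real^'q) set \<Rightarrow> (nat \<Rightarrow> real^'q \<Rightarrow> (nat \<Rightarrow> real^'d) \<Rightarrow> real) \<Rightarrow> bool" where
  "statistical_model \<Theta> p \<longleftrightarrow>
     (\<forall>n\<ge>1.
        (\<lambda>(\<xi>, x). p n \<xi> x) \<in> borel_measurable (param_lebesgue \<Theta> \<Otimes>\<^sub>M data_lebesgue n) \<and>
        (\<forall>\<xi>\<in>\<Theta>. (\<forall>x\<in>space (data_lebesgue n). 0 \<le> p n \<xi> x) \<and> prob_space (law p n \<xi>)))"

definition prior :: "(real^'q) set \<Rightarrow> (real^'q \<Rightarrow> real) \<Rightarrow> (real^'q) measure" where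
  "prior \<Theta> \<pi> = density (param_lebesgue \<Theta>) (\<lambda>\<xi>. ennreal (\<pi> \<xi>))"

definition prior_density :: "(real^'q) set \<Rightarrow> (real^'q \<Rightarrow> real) \<Rightarrow> bool" where
  "prior_density \<Theta> \<pi> \<longleftrightarrow>
     \<pi> \<in> borel_measurable (param_lebesgue \<Theta>) \<and> (\<forall>\<xi>\<in>\<Theta>. 0 \<le> \<pi> \<xi>) \<and> prob_space (prior \<Theta> \<pi>)"

definition posterior_density ::
    "(real^'q) set \<Rightarrow> (real^'q \<Rightarrow> real) \<Rightarrow> (nat \<Rightarrow> real^'q \<Rightarrow> (nat \<Rightarrow> real^'d) \<Rightarrow> real)
      \<Rightarrow> nat \<Rightarrow> (nat \<Rightarrow> real^'d) \<Rightarrow> real^'q \<Rightarrow> real" where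
  "posterior_density \<Theta> \<pi> p n X \<xi> =
     p n \<xi> X * \<pi> \<xi> / (\<integral>\<zeta>. p n \<zeta> X * \<pi> \<zeta> \<partial>param_lebesgue \<Theta>)"

definition posterior ::
    "(real^'q) set \<Rightarrow> (real^'q \<Rightarrow> real) \<Rightarrow> (nat \<Rightarrow> real^'q \<Rightarrow> (nat \<Rightarrow> real^'d) \<Rightarrow> real)
      \<Rightarrow> nat \<Rightarrow> (nat \<Rightarrow> real^'d) \<Rightarrow> (real^'q) measure" where
  "posterior \<Theta> \<pi> p n X =
     density (param_lebesgue \<Theta>) (\<lambda>\<xi>. ennreal (posterior_density \<Theta> \<pi> p n X \<xi>))"

text \<open>Optimal values are extended reals, with infimum \<open>\<infinity>\<close> over an empty feasible set.\<close>

definition optimal_value ::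
    "(real^'p) set \<Rightarrow> (real^'p \<Rightarrow> real^'q \<Rightarrow> real) \<Rightarrow> (real^'p \<Rightarrow> real^'q \<Rightarrow> real) \<Rightarrow> real^'q \<Rightarrow> ereal" where
  "optimal_value \<X> f g \<xi>\<^sub>0 = (INF x\<in>{x\<in>\<X>. g x \<xi>\<^sub>0 \<le> 0}. ereal (f x \<xi>\<^sub>0))"

definition has_solution ::
    "(real^'p) set \<Rightarrow> (real^'p \<Rightarrow> real^'q \<Rightarrow> real) \<Rightarrow> (real^'p \<Rightarrow> real^'q \<Rightarrow> real) \<Rightarrow> real^'q \<Rightarrow> bool" where
  "has_solution \<X> f g \<xi>\<^sub>0 \<longleftrightarrow>
     (\<exists>x\<in>\<X>. g x \<xi>\<^sub>0 \<le> 0 \<and> (\<forall>y\<in>\<X>. g y \<xi>\<^sub>0 \<le> 0 \<longrightarrow> f x \<xi>\<^sub>0 \<le> f y \<xi>\<^sub>0))"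

definition bayes_optimal_value ::
    "(real^'p) set \<Rightarrow> (real^'p \<Rightarrow> real^'q \<Rightarrow> real) \<Rightarrow> (real^'p \<Rightarrow> real^'q \<Rightarrow> real) \<Rightarrow> real
      \<Rightarrow> (real^'q) set \<Rightarrow> (real^'q \<Rightarrow> real) \<Rightarrow> (nat \<Rightarrow> real^'q \<Rightarrow> (nat \<Rightarrow> real^'d) \<Rightarrow> real)
      \<Rightarrow> nat \<Rightarrow> (nat \<Rightarrow> real^'d) \<Rightarrow> ereal" where
  "bayes_optimal_value \<X> f g \<beta> \<Theta> \<pi> p n X =
     (INF x\<in>{x\<in>\<X>. measure (posterior \<Theta> \<pi> p n X) {\<xi>\<in>\<Theta>. g x \<xi> \<le> 0} \<ge> \<beta>}.
        ereal (\<integral>\<xi>. f x \<xi> \<partial>posterior \<Theta> \<pi> p n X))"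

text \<open>Losses take values in \<open>ennreal\<close>, since the supremum over \<open>\<X>\<close> may be infinite.\<close>

definition sup_loss ::
    "(real^'p) set \<Rightarrow> (real^'p \<Rightarrow> real^'q \<Rightarrow> real) \<Rightarrow> nat \<Rightarrow> real^'q \<Rightarrow> real^'q \<Rightarrow> ennreal" where
  "sup_loss \<X> h n \<xi> \<xi>\<^sub>0 = of_nat n * (SUP x\<in>\<X>. ennreal \<bar>h x \<xi> - h x \<xi>\<^sub>0\<bar>)"

definition constraint_loss ::
    "(real^'p) set \<Rightarrow> (real^'p \<Rightarrow> real^'q \<Rightarrow> real) \<Rightarrow> nat \<Rightarrow> real^'q \<Rightarrow> real^'q \<Rightarrow> ennreal" where
  "constraint_loss \<X> g = sup_loss \<X> (\<lambda>x \<xi>. indicator {..0} (g x \<xi>))"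

definition test_condition ::
    "(real^'q) set \<Rightarrow> (nat \<Rightarrow> real^'q \<Rightarrow> (nat \<Rightarrow> real^'d) \<Rightarrow> real) \<Rightarrow> real^'q \<Rightarrow> (nat \<Rightarrow> real)
      \<Rightarrow> real \<Rightarrow> real \<Rightarrow> real \<Rightarrow> (nat \<Rightarrow> real^'q \<Rightarrow> real^'q \<Rightarrow> ennreal) \<Rightarrow> (nat \<Rightarrow> real \<Rightarrow> (real^'q) set) \<Rightarrow> bool" where
  "test_condition \<Theta> p \<xi>\<^sub>0 \<epsilon> C C\<^sub>0 C\<^sub>1 L S \<longleftrightarrow>
     (\<forall>n\<ge>1. \<forall>e>\<epsilon> n.
        S n e \<subseteq> \<Theta> \<and> S n e \<in> sets (param_lebesgue \<Theta>) \<and>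
        (\<exists>\<phi> \<in> borel_measurable (data_lebesgue n).
           (\<forall>x\<in>space (data_lebesgue n). 0 \<le> \<phi> x \<and> \<phi> x \<le> 1) \<and>
           (\<integral>x. \<phi> x \<partial>law p n \<xi>\<^sub>0) \<le> C\<^sub>0 * exp (- C * real n * e^2) \<and>
           (SUP \<xi>\<in>{\<xi>\<in>S n e. L n \<xi> \<xi>\<^sub>0 \<ge> ennreal (C\<^sub>1 * real n * e^2)}.
              ereal (\<integral>x. 1 - \<phi> x \<partial>law p n \<xi>)) \<le> ereal (exp (- C * real n * e^2))))"

definition sieve_mass_condition ::
    "(real^'q) set \<Rightarrow> (real^'q \<Rightarrow> real) \<Rightarrow> (nat \<Rightarrow> real) \<Rightarrow> real \<Rightarrow> (nat \<Rightarrow> real \<Rightarrow> (real^'q) set) \<Rightarrow> bool" where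
  "sieve_mass_condition \<Theta> \<pi> \<epsilon> C S \<longleftrightarrow>
     (\<forall>n\<ge>1. \<forall>e>\<epsilon> n. measure (prior \<Theta> \<pi>) (\<Theta> - S n e) \<le> exp (- C * real n * e^2))"

text \<open>The Renyi divergence of order \<open>\<alpha> > 1\<close>, equal to \<open>\<infinity>\<close> if \<open>P\<close> is not absolutely continuous with
  respect to \<open>Q\<close>. For absolutely continuous \<open>P\<close> the derivative is finite almost everywhere, so
  \<open>enn2real\<close> does not affect the integral.\<close>

definition renyi_divergence :: "real \<Rightarrow> 'a measure \<Rightarrow> 'a measure \<Rightarrow> ereal" where
  "renyi_divergence \<alpha> P Q =
     (let I = (\<integral>\<^sup>+x. ennreal (enn2real (RN_deriv Q P x) powr (\<alpha> - 1)) \<partial>P) in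
      if absolutely_continuous Q P \<and> I < \<infinity> then ereal (1 / (\<alpha> - 1) * ln (enn2real I)) else \<infinity>)"

definition prior_mass_condition ::
    "(real^'q) set \<Rightarrow> (real^'q \<Rightarrow> real) \<Rightarrow> (nat \<Rightarrow> real^'q \<Rightarrow> (nat \<Rightarrow> real^'d) \<Rightarrow> real) \<Rightarrow> real^'q
      \<Rightarrow> (nat \<Rightarrow> real) \<Rightarrow> real \<Rightarrow> real \<Rightarrow> real \<Rightarrow> bool" where
  "prior_mass_condition \<Theta> \<pi> p \<xi>\<^sub>0 \<epsilon> C\<^sub>2 C\<^sub>3 \<kappa> \<longleftrightarrow>
     (\<forall>n\<ge>1. measure (prior \<Theta> \<pi>)
          {\<xi>\<in>\<Theta>. renyi_divergence (1 + \<kappa>) (law p n \<xi>\<^sub>0) (law p n \<xi>) \<le> ereal (C\<^sub>3 * real n * (\<epsilon> n)^2)}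
        \<ge> exp (- real n * C\<^sub>2 * (\<epsilon> n)^2))"

end

theory Submission
  imports Defs "HOL-Real_Asymp.Real_Asymp"
begin

text \<open>The posterior is written as a ratio: the posterior mean of \<open>u\<close> given \<open>x\<close> is the prior integral of
  \<open>u \<xi> * p \<xi> x\<close> divided by the evidence, the prior integral of \<open>p \<xi> x\<close>. Two facts control it under the
  true law. By the prior-mass condition the evidence is rarely much smaller than the true density
  (\<open>small_evidence_prob\<close>). By Fubini, the numerator of the posterior probability of a set \<open>B\<close>, weighted by
  \<open>1 - \<phi>\<close> for a test \<open>\<phi>\<close>, integrates to the prior average over \<open>B\<close> of the type II errors of \<open>\<phi>\<close>, which is
  exponentially small when every parameter of \<open>B\<close> has a small type II error or lies outside the sieve,
  a set of small prior mass. Together they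
  give an exponential bound on the expected posterior probability of \<open>B\<close> (\<open>posterior_tail_prob_le\<close>).

  The loss is a supremum over an uncountable set and may fail to be measurable in the parameter. The
  set of parameters whose type II error is at most a given bound, however, is measurable by Fubini and contains all
  parameters of the sieve with large loss. Summing the indicators of such sets over the radii \<open>\<epsilon>\<^sub>n * sqrt (k + 2)\<close>
  gives a measurable majorant \<open>F\<close> of \<open>L\<^sub>n / n\<close>; since \<open>n * \<epsilon>\<^sub>n\<^sup>2 \<ge> 1\<close>, the exponential bounds add
  up to a constant free of \<open>n\<close>, so that the expected posterior mean of \<open>F\<close> is at most a constant
  times \<open>\<epsilon>\<^sub>n\<^sup>2\<close> (\<open>loss_posterior_mean_le\<close>).

  The rest is deterministic (\<open>optimal_value_stable\<close>). Let \<open>G\<close> and \<open>F\<close> be the majorants for the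
  constraint and the cost. If the posterior mean of \<open>G\<close> is below \<open>min \<delta> (1 - \<beta>)\<close>, a truly feasible point
  satisfies its constraint with posterior probability at least \<open>\<beta>\<close>, and a truly infeasible one with
  probability below \<open>\<delta> < \<beta>\<close>: the chance constraint has exactly the true feasible set. On that
  common set the two objectives differ by at most the posterior mean of \<open>F\<close>, and so do their
  infima. Markov's inequality for the two posterior means gives the two terms of the bound.\<close>

section \<open>Posterior contraction in a dominated model\<close>

text \<open>The convex function \<open>u powr (- a)\<close> lies above its tangent at \<open>1\<close>. Integrating this inequality
  over a subset gives Jensen's inequality for the restricted prior without normalising it.\<close>

lemma tangent_neg_powr:
  fixes u a :: real
  assumes "0 < u" and "0 \<le> a"
  shows "1 + a \<le> u powr (- a) + a * u"
proof -
  have "a * ln u \<le> a * (u - 1)"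
    using assms ln_le_minus_one[of u] by (intro mult_left_mono) auto
  moreover have "1 + (- a) * ln u \<le> exp ((- a) * ln u)"
    using exp_ge_add_one_self by blast
  moreover have "exp ((- a) * ln u) = u powr (- a)"
    using assms by (simp add: powr_def)
  ultimately show ?thesis by (simp add: algebra_simps)
qed

text \<open>One fixed sample size: \<open>\<nu>\<close> is the prior, \<open>\<mu>\<close> dominates the laws \<open>p \<xi>\<close>, and \<open>p0\<close> is the density
  of the law from which the data come.\<close>

locale dominated_model = Par: prob_space \<nu> + Dat: sigma_finite_measure \<mu>
  for \<nu> :: "'b measure" and \<mu> :: "'a measure" +
  fixes p :: "'b \<Rightarrow> 'a \<Rightarrow> real" and p0 :: "'a \<Rightarrow> real"
  assumes p_measurable: "(\<lambda>(\<xi>, x). p \<xi> x) \<in> borel_measurable (\<nu> \<Otimes>\<^sub>M \<mu>)"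
    and p_mass: "\<xi> \<in> space \<nu> \<Longrightarrow> (\<integral>\<^sup>+x. ennreal (p \<xi> x) \<partial>\<mu>) = 1"
    and p0_measurable [measurable]: "p0 \<in> borel_measurable \<mu>"
    and p0_mass: "(\<integral>\<^sup>+x. ennreal (p0 x) \<partial>\<mu>) = 1"
begin

abbreviation truth :: "'a measure" where
  "truth \<equiv> density \<mu> (\<lambda>x. ennreal (p0 x))"

definition evidence :: "'a \<Rightarrow> ennreal" where
  "evidence x = (\<integral>\<^sup>+\<xi>. ennreal (p \<xi> x) \<partial>\<nu>)"

definition posterior_mean :: "('b \<Rightarrow> ennreal) \<Rightarrow> 'a \<Rightarrow> ennreal" where
  "posterior_mean u x = (\<integral>\<^sup>+\<xi>. u \<xi> * ennreal (p \<xi> x) \<partial>\<nu>) / evidence x"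

text \<open>The likelihood ratio to the power \<open>a\<close>, whose expectation under the truth is the exponential of \<open>a\<close> times the
  Renyi divergence of order \<open>1 + a\<close>. It is infinite where \<open>p \<xi>\<close> vanishes: the convention \<open>y / 0 = 0\<close>
  would make it zero exactly where the true density escapes \<open>p \<xi>\<close>.\<close>

definition ratio_power :: "real \<Rightarrow> 'b \<Rightarrow> 'a \<Rightarrow> ennreal" where
  "ratio_power a \<xi> x = (if 0 < p \<xi> x then ennreal ((p0 x / p \<xi> x) powr a) else \<top>)"

sublocale PD: pair_sigma_finite \<nu> \<mu> ..

sublocale truth: prob_space truth
  by (rule prob_spaceI) (simp add: emeasure_density p0_mass cong: nn_integral_cong)

lemma p_pair [measurable]: "(\<lambda>z. p (fst z) (snd z)) \<in> borel_measurable (\<nu> \<Otimes>\<^sub>M \<mu>)"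
  using p_measurable by (simp add: case_prod_beta')

lemma p_data [measurable]: "\<xi> \<in> space \<nu> \<Longrightarrow> (\<lambda>x. p \<xi> x) \<in> borel_measurable \<mu>"
  using measurable_compose[OF measurable_Pair1' p_pair] by simp

lemma p_param [measurable]: "x \<in> space \<mu> \<Longrightarrow> (\<lambda>\<xi>. p \<xi> x) \<in> borel_measurable \<nu>"
  using measurable_compose[OF measurable_Pair2' p_pair] by simp

lemma p_swap [measurable]: "(\<lambda>z. p (snd z) (fst z)) \<in> borel_measurable (\<mu> \<Otimes>\<^sub>M \<nu>)"
  using measurable_compose[OF measurable_pair_swap' p_pair] by (simp add: case_prod_beta')

lemma weighted_measurable:
  assumes [measurable]: "u \<in> borel_measurable \<nu>"
  shows "(\<lambda>x. \<integral>\<^sup>+\<xi>. u \<xi> * ennreal (p \<xi> x) \<partial>\<nu>) \<in> borel_measurable \<mu>"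
  by (rule Par.borel_measurable_nn_integral) (simp add: case_prod_beta')

lemma evidence_measurable [measurable]: "evidence \<in> borel_measurable \<mu>"
  using weighted_measurable[of "\<lambda>_. 1"] by (simp add: evidence_def[abs_def])

lemma posterior_mean_measurable [measurable]:
  "u \<in> borel_measurable \<nu> \<Longrightarrow> posterior_mean u \<in> borel_measurable \<mu>"
  unfolding posterior_mean_def[abs_def]
  using weighted_measurable[of u] by (intro borel_measurable_divide_ennreal) auto

lemma ratio_power_measurable [measurable]:
  "(\<lambda>z. ratio_power a (snd z) (fst z)) \<in> borel_measurable (\<mu> \<Otimes>\<^sub>M \<nu>)"
  "x \<in> space \<mu> \<Longrightarrow> (\<lambda>\<xi>. ratio_power a \<xi> x) \<in> borel_measurable \<nu>"
  unfolding ratio_power_def[abs_def] by measurable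

lemma posterior_mean_le_1:
  assumes "\<And>\<xi>. u \<xi> \<le> 1"
  shows "posterior_mean u x \<le> 1"
proof -
  have "(\<integral>\<^sup>+\<xi>. u \<xi> * ennreal (p \<xi> x) \<partial>\<nu>) \<le> evidence x"
    unfolding evidence_def
  proof (rule nn_integral_mono)
    fix \<xi> show "u \<xi> * ennreal (p \<xi> x) \<le> ennreal (p \<xi> x)"
      using mult_right_mono[OF assms[of \<xi>], of "ennreal (p \<xi> x)"] by simp
  qed
  then show ?thesis
    unfolding posterior_mean_def
    by (cases "evidence x = 0") (auto simp: zero_less_iff_neq_zero intro!: divide_le_posI_ennreal)
qed

lemma nn_integral_truth:
  "h \<in> borel_measurable \<mu> \<Longrightarrow> (\<integral>\<^sup>+x. h x \<partial>truth) = (\<integral>\<^sup>+x. ennreal (p0 x) * h x \<partial>\<mu>)"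
  by (simp add: nn_integral_density)

lemma evidence_finite: "AE x in truth. evidence x < \<top>"
proof -
  have "(\<integral>\<^sup>+x. evidence x \<partial>\<mu>) = (\<integral>\<^sup>+\<xi>. (\<integral>\<^sup>+x. ennreal (p \<xi> x) \<partial>\<mu>) \<partial>\<nu>)"
    unfolding evidence_def by (rule PD.Fubini') (simp add: case_prod_beta')
  also have "\<dots> = 1"
    by (simp add: p_mass Par.emeasure_space_1 cong: nn_integral_cong)
  finally have "AE x in \<mu>. evidence x \<noteq> \<top>"
    by (intro nn_integral_PInf_AE[unfolded infinity_ennreal_def]) auto
  then show ?thesis
    by (auto simp: AE_density less_top)
qed

text \<open>Jensen's inequality for the negative power, in pointwise form: the tangent inequality is taken at
  \<open>u = p \<xi> x / (s * p0 x)\<close> and integrated over \<open>A\<close>. The linear term contributes at most \<open>a\<close> times the mass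
  of \<open>A\<close>, by smallness of the evidence, which leaves the mass of \<open>A\<close> for the power term.\<close>

lemma small_evidence_imp_large_ratio_power:
  assumes x: "x \<in> space \<mu>" and p0: "0 < p0 x" and A: "A \<in> sets \<nu>" and a: "0 < a" and s: "0 < s"
    and small: "evidence x \<le> ennreal (s * p0 x) * emeasure \<nu> A"
  shows "emeasure \<nu> A \<le> ennreal (s powr a) * (\<integral>\<^sup>+\<xi>. indicator A \<xi> * ratio_power a \<xi> x \<partial>\<nu>)"
proof -
  note [measurable] = A p_param[OF x] ratio_power_measurable(2)[OF x]
  let ?c = "s * p0 x"
  have c: "0 < ?c" using s p0 by simp
  have fin: "emeasure \<nu> A < \<top>" by (simp add: less_top[symmetric])
  have pt: "ennreal (1 + a) * indicator A \<xi>
      \<le> ennreal (s powr a) * (indicator A \<xi> * ratio_power a \<xi> x) + ennreal (a / ?c) * ennreal (p \<xi> x)" for \<xi>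
  proof (cases "\<xi> \<in> A")
    case True
    show ?thesis
    proof (cases "0 < p \<xi> x")
      case pos: True
      let ?u = "p \<xi> x / ?c"
      have "1 + a \<le> ?u powr (- a) + a * ?u"
        using pos c a by (intro tangent_neg_powr) auto
      moreover have "?u powr (- a) = s powr a * (p0 x / p \<xi> x) powr a"
        using pos s p0 by (simp add: powr_minus powr_divide powr_mult field_simps)
      ultimately have "1 + a \<le> s powr a * (p0 x / p \<xi> x) powr a + (a / ?c) * p \<xi> x" by simp
      then show ?thesis
        using True pos a c
        by (simp add: ratio_power_def ennreal_mult[symmetric] ennreal_plus[symmetric] del: ennreal_plus)
    next
      case False
      then show ?thesis using True s by (simp add: ratio_power_def ennreal_mult_top)
    qed
  qed simp
  have "ennreal (1 + a) * emeasure \<nu> A = (\<integral>\<^sup>+\<xi>. ennreal (1 + a) * indicator A \<xi> \<partial>\<nu>)"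
    by (simp add: nn_integral_cmult_indicator)
  also have "\<dots> \<le> (\<integral>\<^sup>+\<xi>. ennreal (s powr a) * (indicator A \<xi> * ratio_power a \<xi> x)
      + ennreal (a / ?c) * ennreal (p \<xi> x) \<partial>\<nu>)"
    by (intro nn_integral_mono pt)
  also have "\<dots> = ennreal (s powr a) * (\<integral>\<^sup>+\<xi>. indicator A \<xi> * ratio_power a \<xi> x \<partial>\<nu>)
      + ennreal (a / ?c) * evidence x"
    unfolding evidence_def by (subst nn_integral_add) (auto simp: nn_integral_cmult)
  also have "ennreal (a / ?c) * evidence x \<le> ennreal (a / ?c) * (ennreal ?c * emeasure \<nu> A)"
    by (intro mult_left_mono small) auto
  also have "\<dots> = ennreal a * emeasure \<nu> A"
    using s p0 a by (simp add: mult.assoc[symmetric] ennreal_mult[symmetric])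
  finally have "emeasure \<nu> A + ennreal a * emeasure \<nu> A
      \<le> ennreal (s powr a) * (\<integral>\<^sup>+\<xi>. indicator A \<xi> * ratio_power a \<xi> x \<partial>\<nu>) + ennreal a * emeasure \<nu> A"
    using a by (simp add: distrib_right add_left_mono)
  moreover have "ennreal a * emeasure \<nu> A < \<top>" using fin by (simp add: ennreal_mult_less_top)
  ultimately show ?thesis
    by (auto simp: add.commute[of _ "ennreal a * emeasure \<nu> A"] ennreal_add_left_cancel_le)
qed

lemma small_evidence_sets:
  "{x \<in> space \<mu>. evidence x \<le> ennreal (d * p0 x) * K} \<in> sets \<mu>"
  by (intro borel_measurable_le evidence_measurable) simp

text \<open>Small evidence forces the average over \<open>A\<close> of \<open>ratio_power\<close> to be large, but the expectation of that average
  is at most \<open>exp (a * c)\<close> times the mass of \<open>A\<close>; so Markov's inequality applies.\<close>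

lemma small_evidence_prob:
  assumes A: "A \<in> sets \<nu>" and a: "0 < a" and pos: "0 < emeasure \<nu> A"
    and div: "\<And>\<xi>. \<xi> \<in> A \<Longrightarrow> (\<integral>\<^sup>+x. ratio_power a \<xi> x \<partial>truth) \<le> ennreal (exp (a * c))"
  shows "emeasure truth {x \<in> space \<mu>. evidence x \<le> ennreal (exp (- (c + t)) * p0 x) * emeasure \<nu> A}
      \<le> ennreal (exp (- a * t))"
proof -
  note [measurable] = A
  let ?E = "{x \<in> space \<mu>. evidence x \<le> ennreal (exp (- (c + t)) * p0 x) * emeasure \<nu> A}"
  let ?J = "\<lambda>x. \<integral>\<^sup>+\<xi>. indicator A \<xi> * ratio_power a \<xi> x \<partial>\<nu>"
  let ?s = "exp (- (c + t))"
  interpret TP: pair_sigma_finite truth \<nu> ..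
  have m: "(\<lambda>z. indicator A (snd z) * ratio_power a (snd z) (fst z)) \<in> borel_measurable (\<mu> \<Otimes>\<^sub>M \<nu>)"
    by measurable
  have m': "(\<lambda>z. indicator A (snd z) * ratio_power a (snd z) (fst z)) \<in> borel_measurable (truth \<Otimes>\<^sub>M \<nu>)"
    using m by (simp cong: measurable_cong_sets sets_pair_measure_cong)
  have J [measurable]: "?J \<in> borel_measurable \<mu>"
    using m by (intro Par.borel_measurable_nn_integral) (simp add: case_prod_beta')
  have AEp0: "AE x in truth. 0 < p0 x"
    by (auto simp: AE_density)
  have fin: "emeasure \<nu> A \<noteq> \<top>" by simp
  have E: "?E \<in> sets truth" unfolding sets_density by (rule small_evidence_sets)
  have "(\<integral>\<^sup>+x. ?J x \<partial>truth) = (\<integral>\<^sup>+\<xi>. (\<integral>\<^sup>+x. indicator A \<xi> * ratio_power a \<xi> x \<partial>truth) \<partial>\<nu>)"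
    using m' by (intro TP.Fubini'[symmetric]) (simp add: case_prod_beta')
  also have "\<dots> \<le> (\<integral>\<^sup>+\<xi>. ennreal (exp (a * c)) * indicator A \<xi> \<partial>\<nu>)"
    by (intro nn_integral_mono) (auto simp: indicator_def div)
  also have "\<dots> = ennreal (exp (a * c)) * emeasure \<nu> A"
    by (simp add: nn_integral_cmult_indicator)
  finally have EJ: "(\<integral>\<^sup>+x. ?J x \<partial>truth) \<le> ennreal (exp (a * c)) * emeasure \<nu> A" .
  have "emeasure \<nu> A * emeasure truth ?E = (\<integral>\<^sup>+x. emeasure \<nu> A * indicator ?E x \<partial>truth)"
    using E by (simp only: nn_integral_cmult_indicator)
  also have "\<dots> \<le> (\<integral>\<^sup>+x. ennreal (?s powr a) * ?J x \<partial>truth)"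
  proof (rule nn_integral_mono_AE, use AEp0 AE_space in eventually_elim)
    fix x assume "0 < p0 x" "x \<in> space truth"
    then show "emeasure \<nu> A * indicator ?E x \<le> ennreal (?s powr a) * ?J x"
      using small_evidence_imp_large_ratio_power[of x A a ?s] A a by (auto simp: indicator_def)
  qed
  also have "\<dots> = ennreal (?s powr a) * (\<integral>\<^sup>+x. ?J x \<partial>truth)"
    by (simp add: nn_integral_cmult)
  also have "\<dots> \<le> ennreal (?s powr a) * (ennreal (exp (a * c)) * emeasure \<nu> A)"
    by (intro mult_left_mono EJ) simp
  also have "\<dots> = ennreal (exp (- a * t)) * emeasure \<nu> A"
    by (simp add: mult.assoc[symmetric] ennreal_mult[symmetric] powr_def exp_add[symmetric] algebra_simps)
  finally have "emeasure \<nu> A * emeasure truth ?E \<le> emeasure \<nu> A * ennreal (exp (- a * t))"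
    by (simp add: mult.commute)
  then show ?thesis
    using pos fin by (subst (asm) ennreal_mult_le_mult_iff) auto
qed

text \<open>Without this fact the posterior could be degenerate on an event of positive probability. Zero
  evidence is small evidence at every level \<open>t\<close>, and the probability of the latter vanishes as \<open>t\<close> grows.\<close>

lemma evidence_positive:
  assumes A: "A \<in> sets \<nu>" and a: "0 < a" and pos: "0 < emeasure \<nu> A"
    and div: "\<And>\<xi>. \<xi> \<in> A \<Longrightarrow> (\<integral>\<^sup>+x. ratio_power a \<xi> x \<partial>truth) \<le> ennreal (exp (a * c))"
  shows "AE x in truth. 0 < evidence x"
proof -
  let ?N = "{x \<in> space \<mu>. evidence x = 0}"
  have "emeasure truth ?N \<le> ennreal (exp (- a * real k))" for k
  proof -
    have "emeasure truth ?N \<le> emeasure truth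
        {x \<in> space \<mu>. evidence x \<le> ennreal (exp (- (c + real k)) * p0 x) * emeasure \<nu> A}"
      by (intro emeasure_mono) auto
    also have "\<dots> \<le> ennreal (exp (- a * real k))"
      by (intro small_evidence_prob assms)
    finally show ?thesis .
  qed
  moreover have "(\<lambda>k. ennreal (exp (- a * real k))) \<longlonglongrightarrow> ennreal 0"
    using a by (intro tendsto_ennrealI) real_asymp
  ultimately have "emeasure truth ?N \<le> 0"
    using LIMSEQ_le_const by (metis (no_types, lifting) ennreal_0)
  then have "?N \<in> null_sets truth" by (auto simp: null_sets_def)
  then show ?thesis
    by (rule AE_I') (auto simp: zero_less_iff_neq_zero)
qed

text \<open>The classical testing argument. The posterior probability is at most one, so it is bounded by \<open>\<phi>\<close>, plus
  the indicator of the event \<open>E\<close> of small evidence, plus \<open>1 - \<phi>\<close> times the posterior probability off \<open>E\<close>. In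
  this last part the evidence in the denominator may be replaced by its lower bound, a multiple of
  the true density; that density cancels, and Fubini turns what remains into type II errors.\<close>

lemma posterior_prob_le:
  assumes A: "A \<in> sets \<nu>" and a: "0 < a" and pos: "0 < emeasure \<nu> A"
    and div: "\<And>\<xi>. \<xi> \<in> A \<Longrightarrow> (\<integral>\<^sup>+x. ratio_power a \<xi> x \<partial>truth) \<le> ennreal (exp (a * c))"
    and B: "B \<in> sets \<nu>"
    and \<phi> [measurable]: "\<phi> \<in> borel_measurable \<mu>"
    and \<phi>_range: "\<And>x. x \<in> space \<mu> \<Longrightarrow> 0 \<le> \<phi> x \<and> \<phi> x \<le> 1"
  shows "(\<integral>\<^sup>+x. posterior_mean (indicator B) x \<partial>truth)
    \<le> (\<integral>\<^sup>+x. ennreal (\<phi> x) \<partial>truth) + ennreal (exp (- a * t))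
      + ennreal (exp (c + t)) / emeasure \<nu> A
        * (\<integral>\<^sup>+\<xi>. indicator B \<xi> * (\<integral>\<^sup>+x. ennreal (1 - \<phi> x) * ennreal (p \<xi> x) \<partial>\<mu>) \<partial>\<nu>)"
proof -
  note [measurable] = A B
  define E where "E = {x \<in> space \<mu>. evidence x \<le> ennreal (exp (- (c + t)) * p0 x) * emeasure \<nu> A}"
  let ?K = "ennreal (exp (c + t)) / emeasure \<nu> A"
  let ?N = "\<lambda>x. \<integral>\<^sup>+\<xi>. indicator B \<xi> * ennreal (p \<xi> x) \<partial>\<nu>"
  have fin: "emeasure \<nu> A \<noteq> \<top>" by simp
  have N [measurable]: "?N \<in> borel_measurable \<mu>" by (rule weighted_measurable) measurable
  have E_sets [measurable]: "E \<in> sets \<mu>"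
    unfolding E_def by (rule small_evidence_sets)
  define R where "R = (\<lambda>x. ennreal (1 - \<phi> x) * posterior_mean (indicator B) x * indicator (space \<mu> - E) x)"
  have R [measurable]: "R \<in> borel_measurable \<mu>"
    unfolding R_def using posterior_mean_measurable[of "indicator B"] by measurable
  have pt: "posterior_mean (indicator B) x \<le> ennreal (\<phi> x) + indicator E x + R x"
    if x: "x \<in> space \<mu>" for x
  proof (cases "x \<in> E")
    case True
    have "posterior_mean (indicator B) x \<le> 1" by (rule posterior_mean_le_1) (simp add: indicator_def)
    also have "1 \<le> ennreal (\<phi> x) + indicator E x + R x" using True by (simp add: add_increasing add_increasing2)
    finally show ?thesis .
  next
    case False
    let ?P = "posterior_mean (indicator B) x"
    have P1: "?P \<le> 1" by (rule posterior_mean_le_1) (simp add: indicator_def)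
    have "?P = (ennreal (\<phi> x) + ennreal (1 - \<phi> x)) * ?P"
      using \<phi>_range[OF x] by (simp add: ennreal_plus[symmetric] del: ennreal_plus)
    also have "\<dots> = ennreal (\<phi> x) * ?P + ennreal (1 - \<phi> x) * ?P" by (simp add: distrib_right)
    also have "\<dots> \<le> ennreal (\<phi> x) * 1 + ennreal (1 - \<phi> x) * ?P"
      by (intro add_mono mult_left_mono P1) auto
    finally show ?thesis using False x by (simp add: R_def)
  qed
  have R_pt: "ennreal (p0 x) * R x \<le> ?K * (ennreal (1 - \<phi> x) * ?N x)" if x: "x \<in> space \<mu>" for x
  proof (cases "x \<in> E \<or> p0 x \<le> 0")
    case True then show ?thesis by (auto simp: R_def ennreal_neg)
  next
    case False
    let ?q = "ennreal (exp (- (c + t)) * p0 x) * emeasure \<nu> A"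
    have q: "0 < ?q" "?q \<le> evidence x" using False x pos by (auto simp: E_def ennreal_zero_less_mult_iff)
    obtain m where m: "emeasure \<nu> A = ennreal m" "0 < m"
      using pos fin by (cases "emeasure \<nu> A") auto
    define r where "r = exp (- (c + t)) * p0 x * m"
    have r: "0 < r" "?q = ennreal r"
      using m False by (auto simp: r_def ennreal_mult)
    \<comment> \<open>Division by \<open>?q\<close> is carried out on reals, where the true density cancels.\<close>
    have "?N x = ?q * (ennreal (1 / r) * ?N x)"
      using r by (simp add: mult.assoc[symmetric] ennreal_mult[symmetric])
    also have "\<dots> \<le> evidence x * (ennreal (1 / r) * ?N x)"
      by (intro mult_right_mono q) simp
    finally have "posterior_mean (indicator B) x \<le> ennreal (1 / r) * ?N x"
      unfolding posterior_mean_def using q by (intro divide_le_posI_ennreal) auto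
    then have "ennreal (p0 x) * posterior_mean (indicator B) x \<le> ennreal (p0 x) * (ennreal (1 / r) * ?N x)"
      by (intro mult_left_mono) auto
    also have "\<dots> = ennreal (p0 x * (1 / r)) * ?N x"
      using r(1) False by (subst ennreal_mult) (auto simp: mult.assoc)
    also have "p0 x * (1 / r) = exp (c + t) / m"
      using False m by (simp add: r_def exp_minus field_simps exp_add exp_diff)
    also have "ennreal \<dots> = ?K" using m by (simp add: divide_ennreal)
    finally have "ennreal (1 - \<phi> x) * (ennreal (p0 x) * posterior_mean (indicator B) x)
        \<le> ennreal (1 - \<phi> x) * (?K * ?N x)"
      by (intro mult_left_mono) auto
    then show ?thesis using False x by (simp add: R_def mult_ac)
  qed
  have "(\<integral>\<^sup>+x. posterior_mean (indicator B) x \<partial>truth)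
      \<le> (\<integral>\<^sup>+x. ennreal (\<phi> x) + indicator E x + R x \<partial>truth)"
    by (intro nn_integral_mono) (use pt in simp)
  also have "\<dots> = (\<integral>\<^sup>+x. ennreal (\<phi> x) \<partial>truth) + emeasure truth E + (\<integral>\<^sup>+x. R x \<partial>truth)"
    by (subst nn_integral_add, measurable, subst nn_integral_add, measurable)
  also have "emeasure truth E \<le> ennreal (exp (- a * t))"
    unfolding E_def by (intro small_evidence_prob assms)
  also have "(\<integral>\<^sup>+x. R x \<partial>truth) = (\<integral>\<^sup>+x. ennreal (p0 x) * R x \<partial>\<mu>)"
    by (intro nn_integral_truth) measurable
  also have "\<dots> \<le> (\<integral>\<^sup>+x. ?K * (ennreal (1 - \<phi> x) * ?N x) \<partial>\<mu>)"
    by (intro nn_integral_mono R_pt)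
  also have "\<dots> = ?K * (\<integral>\<^sup>+x. ennreal (1 - \<phi> x) * ?N x \<partial>\<mu>)"
    by (intro nn_integral_cmult) measurable
  also have "(\<integral>\<^sup>+x. ennreal (1 - \<phi> x) * ?N x \<partial>\<mu>)
      = (\<integral>\<^sup>+x. (\<integral>\<^sup>+\<xi>. indicator B \<xi> * (ennreal (1 - \<phi> x) * ennreal (p \<xi> x)) \<partial>\<nu>) \<partial>\<mu>)"
    by (intro nn_integral_cong) (simp add: nn_integral_cmult[symmetric] mult_ac)
  also have "\<dots> = (\<integral>\<^sup>+\<xi>. (\<integral>\<^sup>+x. indicator B \<xi> * (ennreal (1 - \<phi> x) * ennreal (p \<xi> x)) \<partial>\<mu>) \<partial>\<nu>)"
    by (rule PD.Fubini') (simp add: case_prod_beta')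
  also have "\<dots> = (\<integral>\<^sup>+\<xi>. indicator B \<xi> * (\<integral>\<^sup>+x. ennreal (1 - \<phi> x) * ennreal (p \<xi> x) \<partial>\<mu>) \<partial>\<nu>)"
    by (intro nn_integral_cong nn_integral_cmult) measurable
  finally show ?thesis by (simp add: add_mono add_left_mono add_right_mono)
qed


text \<open>The set \<open>B\<close> consists of the complement of the sieve \<open>S\<close> and of all parameters with type II error at most \<open>\<rho>\<close>.
  It serves as a measurable substitute for the set of parameters with large loss.\<close>

lemma posterior_tail_prob_le:
  assumes A: "A \<in> sets \<nu>" and a: "0 < a" and pos: "0 < emeasure \<nu> A"
    and div: "\<And>\<xi>. \<xi> \<in> A \<Longrightarrow> (\<integral>\<^sup>+x. ratio_power a \<xi> x \<partial>truth) \<le> ennreal (exp (a * c))"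
    and S: "S \<in> sets \<nu>" and S_mass: "emeasure \<nu> (space \<nu> - S) \<le> ennreal \<rho>"
    and \<phi> [measurable]: "\<phi> \<in> borel_measurable \<mu>"
    and \<phi>_range: "\<And>x. x \<in> space \<mu> \<Longrightarrow> 0 \<le> \<phi> x \<and> \<phi> x \<le> 1"
  obtains B where "B \<in> sets \<nu>" and "space \<nu> - S \<subseteq> B"
    and "\<And>\<xi>. \<xi> \<in> S \<Longrightarrow> (\<integral>\<^sup>+x. ennreal (1 - \<phi> x) * ennreal (p \<xi> x) \<partial>\<mu>) \<le> ennreal \<rho> \<Longrightarrow> \<xi> \<in> B"
    and "(\<integral>\<^sup>+x. posterior_mean (indicator B) x \<partial>truth)
      \<le> (\<integral>\<^sup>+x. ennreal (\<phi> x) \<partial>truth) + ennreal (exp (- a * t))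
        + ennreal (exp (c + t)) / emeasure \<nu> A * (ennreal \<rho> + ennreal \<rho>)"
proof -
  let ?T = "\<lambda>\<xi>. \<integral>\<^sup>+x. ennreal (1 - \<phi> x) * ennreal (p \<xi> x) \<partial>\<mu>"
  have T [measurable]: "?T \<in> borel_measurable \<nu>"
    by (rule Dat.borel_measurable_nn_integral) (simp add: case_prod_beta')
  note [measurable] = S
  define B where "B = {\<xi> \<in> space \<nu>. ?T \<xi> \<le> ennreal \<rho>} \<union> (space \<nu> - S)"
  have B [measurable]: "B \<in> sets \<nu>" unfolding B_def by measurable
  have T1: "?T \<xi> \<le> 1" if "\<xi> \<in> space \<nu>" for \<xi>
  proof -
    have "ennreal (1 - \<phi> x) * ennreal (p \<xi> x) \<le> 1 * ennreal (p \<xi> x)" if "x \<in> space \<mu>" for x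
      using \<phi>_range[OF that] by (intro mult_right_mono) auto
    then have "?T \<xi> \<le> (\<integral>\<^sup>+x. ennreal (p \<xi> x) \<partial>\<mu>)"
      by (intro nn_integral_mono) simp
    then show ?thesis using p_mass[OF that] by simp
  qed
  have "(\<integral>\<^sup>+\<xi>. indicator B \<xi> * ?T \<xi> \<partial>\<nu>) \<le> (\<integral>\<^sup>+\<xi>. ennreal \<rho> + indicator (space \<nu> - S) \<xi> \<partial>\<nu>)"
  proof (rule nn_integral_mono)
    fix \<xi> assume x: "\<xi> \<in> space \<nu>"
    show "indicator B \<xi> * ?T \<xi> \<le> ennreal \<rho> + indicator (space \<nu> - S) \<xi>"
      using T1[OF x] x by (auto simp: indicator_def B_def intro: add_increasing add_increasing2)
  qed
  also have "\<dots> = ennreal \<rho> + emeasure \<nu> (space \<nu> - S)"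
    by (subst nn_integral_add) (auto simp: Par.emeasure_space_1)
  also have "\<dots> \<le> ennreal \<rho> + ennreal \<rho>" by (intro add_left_mono S_mass)
  finally have int: "(\<integral>\<^sup>+\<xi>. indicator B \<xi> * ?T \<xi> \<partial>\<nu>) \<le> ennreal \<rho> + ennreal \<rho>" .
  show thesis
  proof (rule that[OF B])
    show "space \<nu> - S \<subseteq> B" by (auto simp: B_def)
    show "\<xi> \<in> B" if "\<xi> \<in> S" "?T \<xi> \<le> ennreal \<rho>" for \<xi>
      using that sets.sets_into_space[OF S] by (auto simp: B_def)
    show "(\<integral>\<^sup>+x. posterior_mean (indicator B) x \<partial>truth)
      \<le> (\<integral>\<^sup>+x. ennreal (\<phi> x) \<partial>truth) + ennreal (exp (- a * t))
        + ennreal (exp (c + t)) / emeasure \<nu> A * (ennreal \<rho> + ennreal \<rho>)"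
      by (rule order_trans[OF posterior_prob_le[OF A a pos div B \<phi> \<phi>_range]])
         (auto intro!: add_left_mono mult_left_mono int)
  qed
qed

section \<open>Layered majorants of the loss\<close>

text \<open>The leading \<open>2\<close> and the weight \<open>c\<close> match the levels \<open>c * (k + 2)\<close> of \<open>le_layer_cake\<close> below. The posterior
  mean passes through the series by monotone convergence.\<close>

lemma posterior_mean_layer_cake:
  assumes B [measurable]: "\<And>k. B k \<in> sets \<nu>"
    and b: "\<And>k. (\<integral>\<^sup>+x. posterior_mean (indicator (B k)) x \<partial>truth) \<le> ennreal (b k)"
    and b_nonneg: "\<And>k. 0 \<le> b k" and summable: "summable b" and c: "0 \<le> c"
  shows "(\<integral>\<^sup>+x. posterior_mean (\<lambda>\<xi>. ennreal c * (2 + (\<Sum>k. indicator (B k) \<xi>))) x \<partial>truth)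
    \<le> ennreal (c * (2 + (\<Sum>k. b k)))"
proof -
  let ?N = "\<lambda>k x. \<integral>\<^sup>+\<xi>. indicator (B k) \<xi> * ennreal (p \<xi> x) \<partial>\<nu>"
  have pt: "posterior_mean (\<lambda>\<xi>. ennreal c * (2 + (\<Sum>k. indicator (B k) \<xi>))) x
      \<le> ennreal c * (2 + (\<Sum>k. posterior_mean (indicator (B k)) x))" if x: "x \<in> space \<mu>" for x
  proof -
    note [measurable] = p_param[OF x]
    have "(\<integral>\<^sup>+\<xi>. ennreal c * (2 + (\<Sum>k. indicator (B k) \<xi>)) * ennreal (p \<xi> x) \<partial>\<nu>)
      = (\<integral>\<^sup>+\<xi>. ennreal c * (2 * ennreal (p \<xi> x) + (\<Sum>k. indicator (B k) \<xi> * ennreal (p \<xi> x))) \<partial>\<nu>)"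
      by (intro nn_integral_cong) (simp add: distrib_left distrib_right mult.assoc)
    also have "\<dots> = ennreal c * (2 * evidence x + (\<Sum>k. ?N k x))"
      unfolding evidence_def
      by (subst nn_integral_cmult, measurable, subst nn_integral_add, measurable,
          subst nn_integral_suminf, measurable, subst nn_integral_cmult, measurable)
    finally have "posterior_mean (\<lambda>\<xi>. ennreal c * (2 + (\<Sum>k. indicator (B k) \<xi>))) x
      = ennreal c * (2 * (evidence x * inverse (evidence x)) + (\<Sum>k. ?N k x * inverse (evidence x)))"
      by (simp add: posterior_mean_def divide_ennreal_def distrib_right mult.assoc)
    also have "\<dots> \<le> ennreal c * (2 * 1 + (\<Sum>k. ?N k x * inverse (evidence x)))"
    proof (intro mult_left_mono add_right_mono)
      show "evidence x * inverse (evidence x) \<le> 1"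
        using posterior_mean_le_1[of "\<lambda>_. 1" x]
        by (simp add: posterior_mean_def evidence_def divide_ennreal_def)
    qed auto
    finally show ?thesis by (simp add: posterior_mean_def divide_ennreal_def)
  qed
  have "(\<integral>\<^sup>+x. posterior_mean (\<lambda>\<xi>. ennreal c * (2 + (\<Sum>k. indicator (B k) \<xi>))) x \<partial>truth)
      \<le> (\<integral>\<^sup>+x. ennreal c * (2 + (\<Sum>k. posterior_mean (indicator (B k)) x)) \<partial>truth)"
    by (intro nn_integral_mono) (use pt in simp)
  also have "\<dots> = ennreal c * (2 + (\<Sum>k. \<integral>\<^sup>+x. posterior_mean (indicator (B k)) x \<partial>truth))"
    by (subst nn_integral_cmult, measurable, subst nn_integral_add, measurable,
        subst nn_integral_suminf, measurable, simp add: truth.emeasure_space_1[simplified])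
  also have "\<dots> \<le> ennreal c * (2 + (\<Sum>k. ennreal (b k)))"
    by (intro mult_left_mono add_left_mono suminf_le b) auto
  also have "(\<Sum>k. ennreal (b k)) = ennreal (\<Sum>k. b k)"
    by (intro suminf_ennreal2 b_nonneg summable)
  also have "ennreal c * (2 + ennreal (\<Sum>k. b k)) = ennreal (c * (2 + (\<Sum>k. b k)))"
    using c suminf_nonneg[OF summable b_nonneg] by (simp add: ennreal_mult)
  finally show ?thesis .
qed

end

text \<open>If \<open>k\<close> is the first index with \<open>\<xi> \<notin> B k\<close>, the series is at least \<open>k\<close>, so the right-hand side is at least
  \<open>c * (k + 2)\<close>. If there is no such index, it is infinite.\<close>

lemma le_layer_cake:
  fixes s :: ennreal and c :: real
  assumes c: "0 < c" and s: "\<And>k. \<xi> \<notin> B k \<Longrightarrow> s \<le> ennreal (c * real (k + 2))"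
  shows "s \<le> ennreal c * (2 + (\<Sum>k. indicator (B k) \<xi>))"
proof -
  let ?I = "\<Sum>k. indicator (B k) \<xi> :: ennreal"
  have ge: "of_nat m \<le> ?I" if "\<And>k. k < m \<Longrightarrow> \<xi> \<in> B k" for m
  proof -
    have "of_nat m = (\<Sum>k<m. indicator (B k) \<xi> :: ennreal)" using that by simp
    also have "\<dots> \<le> ?I" by (intro sum_le_suminf) auto
    finally show ?thesis .
  qed
  show ?thesis
  proof (cases "\<exists>k. \<xi> \<notin> B k")
    case True
    define k where "k = (LEAST k. \<xi> \<notin> B k)"
    have k: "\<xi> \<notin> B k" unfolding k_def using True by (rule LeastI_ex)
    have "of_nat k \<le> ?I" by (rule ge) (use not_less_Least in \<open>auto simp: k_def\<close>)
    then have "ennreal c * (2 + of_nat k) \<le> ennreal c * (2 + ?I)"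
      by (intro mult_left_mono add_left_mono) auto
    moreover have "ennreal (c * real (k + 2)) = ennreal c * (2 + of_nat k)"
      using c by (simp add: ennreal_mult ennreal_of_nat_eq_real_of_nat add.commute)
    ultimately show ?thesis using s[OF k] by simp
  next
    case False
    have "?I = \<top>"
    proof (rule ccontr)
      assume "?I \<noteq> \<top>"
      then obtain m where "?I < of_nat m" using ennreal_Ex_less_of_nat by (auto simp: less_top)
      with ge[of m] False show False by auto
    qed
    then show ?thesis using c by (simp add: ennreal_mult_top)
  qed
qed

section \<open>The Renyi divergence of two densities\<close>

text \<open>The Radon-Nikodym derivative of one density with respect to the other is their quotient, almost
  everywhere where \<open>q0\<close> is positive; there absolute continuity also makes \<open>q\<close> positive, so that the value \<open>\<top>\<close> is
  taken only on a null set of the first law.\<close>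

lemma renyi_divergence_le_imp:
  fixes q q0 :: "'a \<Rightarrow> real"
  assumes [measurable]: "q \<in> borel_measurable \<mu>" "q0 \<in> borel_measurable \<mu>"
    and sf: "sigma_finite_measure \<mu>" and Q: "prob_space (density \<mu> (\<lambda>x. ennreal (q x)))"
    and a: "0 < a"
    and le: "renyi_divergence (1 + a) (density \<mu> (\<lambda>x. ennreal (q0 x))) (density \<mu> (\<lambda>x. ennreal (q x))) \<le> ereal c"
  shows "(\<integral>\<^sup>+x. (if 0 < q x then ennreal ((q0 x / q x) powr a) else \<top>) \<partial>density \<mu> (\<lambda>x. ennreal (q0 x)))
    \<le> ennreal (exp (a * c))"
proof -
  let ?P = "density \<mu> (\<lambda>x. ennreal (q0 x))" and ?Q = "density \<mu> (\<lambda>x. ennreal (q x))"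
  let ?r = "RN_deriv ?Q ?P"
  define I where "I = (\<integral>\<^sup>+x. ennreal (enn2real (?r x) powr a) \<partial>?P)"
  interpret Q: prob_space ?Q by (rule Q)
  interpret \<mu>: sigma_finite_measure \<mu> by (rule sf)
  have ac: "absolutely_continuous ?Q ?P" and I: "I < \<top>" and ln: "1 / a * ln (enn2real I) \<le> c"
    using le by (auto simp: renyi_divergence_def I_def[symmetric] Let_def split: if_splits)
  have r [measurable]: "?r \<in> borel_measurable \<mu>"
    using borel_measurable_RN_deriv[of ?Q ?P] by simp
  have "density ?Q ?r = ?P" using ac by (intro Q.density_RN_deriv) auto
  then have "density \<mu> (\<lambda>x. ennreal (q x) * ?r x) = ?P"
    by (subst (asm) density_density_eq) auto
  then have AE: "AE x in \<mu>. ennreal (q x) * ?r x = ennreal (q0 x)"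
    by (subst (asm) \<mu>.density_unique_iff) auto
  have "AE x in ?P. (if 0 < q x then ennreal ((q0 x / q x) powr a) else \<top>) = ennreal (enn2real (?r x) powr a)"
    unfolding AE_density[OF measurable_compose[OF assms(2) measurable_ennreal]]
    using AE
  proof eventually_elim
    case (elim x)
    show ?case
    proof
      assume "0 < ennreal (q0 x)"
      then have q0: "0 < q0 x" by simp
      then have q: "0 < q x" using elim by (cases "0 < q x") (auto simp: ennreal_neg)
      have "?r x = ennreal (q0 x / q x)"
      proof -
        have "?r x = (ennreal (1 / q x) * ennreal (q x)) * ?r x"
          using q by (simp add: ennreal_mult[symmetric])
        also have "\<dots> = ennreal (1 / q x) * ennreal (q0 x)" by (simp add: mult.assoc elim)
        finally show ?thesis using q q0 by (simp add: ennreal_mult[symmetric])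
      qed
      then show "(if 0 < q x then ennreal ((q0 x / q x) powr a) else \<top>) = ennreal (enn2real (?r x) powr a)"
        using q q0 by simp
    qed
  qed
  then have "(\<integral>\<^sup>+x. (if 0 < q x then ennreal ((q0 x / q x) powr a) else \<top>) \<partial>?P) = I"
    unfolding I_def by (rule nn_integral_cong_AE)
  also have "I = ennreal (enn2real I)" using I by simp
  also have "enn2real I \<le> exp (a * c)"
  proof (cases "enn2real I = 0")
    case False
    then have pos: "0 < enn2real I" using enn2real_nonneg[of I] by linarith
    have "ln (enn2real I) \<le> a * c" using ln a by (simp add: field_simps)
    then show ?thesis using pos by (metis exp_le_cancel_iff exp_ln)
  qed simp
  finally show ?thesis by (simp add: ennreal_leI)
qed

section \<open>Stability of the optimal value\<close>

text \<open>For a point \<open>x\<close>, the set of parameters that disagree with \<open>\<xi>\<^sub>0\<close> on the feasibility of \<open>x\<close> has probability at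
  most the mean of \<open>G\<close>. Hence the chance-constrained feasible set equals the true one, and only the
  objectives differ, uniformly by at most the mean of \<open>F\<close>.\<close>

lemma optimal_value_stable:
  fixes f g :: "real^'p \<Rightarrow> real^'q \<Rightarrow> real"
  assumes "prob_space M"
    and f [measurable]: "\<And>x. x \<in> \<X> \<Longrightarrow> f x \<in> borel_measurable M"
    and g [measurable]: "\<And>x. x \<in> \<X> \<Longrightarrow> g x \<in> borel_measurable M"
    and F: "\<And>x \<xi>. x \<in> \<X> \<Longrightarrow> \<xi> \<in> space M \<Longrightarrow> ennreal \<bar>f x \<xi> - f x \<xi>\<^sub>0\<bar> \<le> F \<xi>"
    and F_int: "(\<integral>\<^sup>+\<xi>. F \<xi> \<partial>M) \<le> ennreal \<eta>" and \<eta>: "0 \<le> \<eta>"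
    and G: "\<And>x \<xi>. x \<in> \<X> \<Longrightarrow> \<xi> \<in> space M
        \<Longrightarrow> ennreal \<bar>indicator {..0} (g x \<xi>) - indicator {..0} (g x \<xi>\<^sub>0)\<bar> \<le> G \<xi>"
    and G_int: "(\<integral>\<^sup>+\<xi>. G \<xi> \<partial>M) \<le> ennreal (1 - \<beta>)" "(\<integral>\<^sup>+\<xi>. G \<xi> \<partial>M) < ennreal \<beta>"
    and \<beta>: "\<beta> \<le> 1"
    and sol: "has_solution \<X> f g \<xi>\<^sub>0"
  shows "\<bar>(INF x\<in>{x\<in>\<X>. \<beta> \<le> measure M {\<xi>\<in>space M. g x \<xi> \<le> 0}}. ereal (\<integral>\<xi>. f x \<xi> \<partial>M))
      - optimal_value \<X> f g \<xi>\<^sub>0\<bar> \<le> ereal \<eta>"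
proof -
  interpret M: prob_space M by fact
  have feasible: "\<beta> \<le> measure M {\<xi>\<in>space M. g x \<xi> \<le> 0} \<longleftrightarrow> g x \<xi>\<^sub>0 \<le> 0" if x: "x \<in> \<X>" for x
  proof -
    note [measurable] = g[OF x]
    let ?P = "{\<xi>\<in>space M. g x \<xi> \<le> 0}"
    let ?D = "{\<xi>\<in>space M. (g x \<xi> \<le> 0) \<noteq> (g x \<xi>\<^sub>0 \<le> 0)}"
    have "ennreal (measure M ?D) = (\<integral>\<^sup>+\<xi>. indicator ?D \<xi> \<partial>M)"
      by (simp add: M.emeasure_eq_measure[symmetric])
    also have "\<dots> \<le> (\<integral>\<^sup>+\<xi>. G \<xi> \<partial>M)"
    proof (rule nn_integral_mono)
      fix \<xi> assume "\<xi> \<in> space M"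
      then show "indicator ?D \<xi> \<le> G \<xi>"
        using G[OF x, of \<xi>] by (auto simp: indicator_def split: if_splits)
    qed
    finally have D: "ennreal (measure M ?D) \<le> (\<integral>\<^sup>+\<xi>. G \<xi> \<partial>M)" .
    show ?thesis
    proof (cases "g x \<xi>\<^sub>0 \<le> 0")
      case True
      have "measure M ?D \<le> 1 - \<beta>"
        using order_trans[OF D G_int(1)] \<beta> by (simp add: ennreal_le_iff)
      moreover have "?D = space M - ?P" using True by auto
      ultimately have "\<beta> \<le> measure M ?P" by (simp add: M.prob_compl)
      with True show ?thesis by simp
    next
      case False
      have "measure M ?D < \<beta>"
        using le_less_trans[OF D G_int(2)] by (simp add: ennreal_less_iff)
      moreover have "?D = ?P" using False by auto
      ultimately show ?thesis using False by auto
    qed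
  qed
  have cost: "\<bar>(\<integral>\<xi>. f x \<xi> \<partial>M) - f x \<xi>\<^sub>0\<bar> \<le> \<eta>" if x: "x \<in> \<X>" for x
  proof -
    note [measurable] = f[OF x]
    have le: "(\<integral>\<^sup>+\<xi>. ennreal (norm (f x \<xi> - f x \<xi>\<^sub>0)) \<partial>M) \<le> ennreal \<eta>"
      using F[OF x] by (intro order_trans[OF nn_integral_mono F_int]) auto
    then have int: "integrable M (\<lambda>\<xi>. f x \<xi> - f x \<xi>\<^sub>0)"
      by (intro integrableI_bounded) (auto intro: le_less_trans)
    then have "integrable M (\<lambda>\<xi>. (f x \<xi> - f x \<xi>\<^sub>0) + f x \<xi>\<^sub>0)"
      by (intro Bochner_Integration.integrable_add) auto
    then have "(\<integral>\<xi>. f x \<xi> - f x \<xi>\<^sub>0 \<partial>M) = (\<integral>\<xi>. f x \<xi> \<partial>M) - f x \<xi>\<^sub>0"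
      by (simp add: M.prob_space)
    moreover have "ennreal (norm (\<integral>\<xi>. f x \<xi> - f x \<xi>\<^sub>0 \<partial>M)) \<le> ennreal \<eta>"
      by (rule order_trans[OF integral_norm_bound_ennreal[OF int] le])
    ultimately show ?thesis using \<eta> by (simp add: ennreal_le_iff)
  qed
  obtain y where y: "y \<in> \<X>" "g y \<xi>\<^sub>0 \<le> 0" and min: "\<And>z. z \<in> \<X> \<Longrightarrow> g z \<xi>\<^sub>0 \<le> 0 \<Longrightarrow> f y \<xi>\<^sub>0 \<le> f z \<xi>\<^sub>0"
    using sol by (auto simp: has_solution_def)
  have opt: "optimal_value \<X> f g \<xi>\<^sub>0 = ereal (f y \<xi>\<^sub>0)"
    unfolding optimal_value_def using y min by (intro antisym INF_lower2[of y] INF_greatest) auto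
  let ?V = "INF x\<in>{x\<in>\<X>. \<beta> \<le> measure M {\<xi>\<in>space M. g x \<xi> \<le> 0}}. ereal (\<integral>\<xi>. f x \<xi> \<partial>M)"
  have "?V \<le> ereal (f y \<xi>\<^sub>0 + \<eta>)"
    using y feasible[OF y(1)] cost[OF y(1)] by (intro INF_lower2[of y]) auto
  moreover have "ereal (f y \<xi>\<^sub>0 - \<eta>) \<le> ?V"
  proof (rule INF_greatest)
    fix x assume "x \<in> {x\<in>\<X>. \<beta> \<le> measure M {\<xi>\<in>space M. g x \<xi> \<le> 0}}"
    then have x: "x \<in> \<X>" "g x \<xi>\<^sub>0 \<le> 0" using feasible by auto
    show "ereal (f y \<xi>\<^sub>0 - \<eta>) \<le> ereal (\<integral>\<xi>. f x \<xi> \<partial>M)"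
      using cost[OF x(1)] min[OF x] by auto
  qed
  ultimately show ?thesis
    unfolding opt by (cases ?V) (auto simp: abs_le_iff)
qed

section \<open>Losses under the posterior\<close>

text \<open>The bound on the expected posterior probability of a loss above the \<open>k\<close>-th level. Its three terms come from
  the type I error, from the event of small evidence, and from the type II errors together with the
  mass outside the sieve. Exponents linear in \<open>n * \<epsilon>\<^sub>n\<^sup>2\<close> are replaced by
  their values at the lower bound \<open>1\<close>, hence the absence of \<open>n\<close>.\<close>

definition tail_bound :: "real \<Rightarrow> real \<Rightarrow> real \<Rightarrow> nat \<Rightarrow> real" where
  "tail_bound C C\<^sub>0 \<kappa> k = C\<^sub>0 * exp (- C * real (k + 2)) + exp (- \<kappa> * real (k + 2)) + 2 * exp (- real (k + 2))"

lemma tail_bound_nonneg: "0 \<le> C\<^sub>0 \<Longrightarrow> 0 \<le> tail_bound C C\<^sub>0 \<kappa> k"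
  by (simp add: tail_bound_def)

lemma summable_tail_bound:
  assumes "0 < C" and "0 < \<kappa>"
  shows "summable (tail_bound C C\<^sub>0 \<kappa>)"
proof -
  have *: "summable (\<lambda>k. exp (- a * real (k + 2)))" if "0 < a" for a :: real
  proof -
    have "summable (\<lambda>k. exp (- 2 * a) * exp (- a) ^ k)"
      using that by (intro summable_mult summable_geometric) simp
    moreover have "exp (- 2 * a) * exp (- a) ^ k = exp (- a * real (k + 2))" for k
      by (simp add: exp_of_nat_mult[symmetric] exp_add[symmetric] algebra_simps)
    ultimately show ?thesis by (simp only:)
  qed
  show ?thesis
    unfolding tail_bound_def[abs_def]
    using *[OF assms(1)] *[OF assms(2)] *[of 1] by (intro summable_add summable_mult) auto
qed

locale posterior_setting =
  fixes \<Theta> :: "(real^'q) set" and \<pi> :: "real^'q \<Rightarrow> real"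
    and p :: "nat \<Rightarrow> real^'q \<Rightarrow> (nat \<Rightarrow> real^'d) \<Rightarrow> real" and n :: nat and \<xi>\<^sub>0 :: "real^'q"
  assumes model: "statistical_model \<Theta> p" and prior: "prior_density \<Theta> \<pi>"
    and truth: "\<xi>\<^sub>0 \<in> \<Theta>" and n: "1 \<le> n"
begin

lemma sets_prior [measurable_cong]: "sets (prior \<Theta> \<pi>) = sets (param_lebesgue \<Theta>)"
  by (simp add: prior_def)

lemma space_param: "space (param_lebesgue \<Theta>) = \<Theta>"
  by (simp add: param_lebesgue_def space_restrict_space)

lemma space_prior: "space (prior \<Theta> \<pi>) = \<Theta>"
  by (simp add: prior_def space_param)

lemma \<pi>_measurable [measurable]: "\<pi> \<in> borel_measurable (param_lebesgue \<Theta>)"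
  using prior by (simp add: prior_density_def)

lemma p_pair_measurable: "(\<lambda>(\<xi>, x). p n \<xi> x) \<in> borel_measurable (prior \<Theta> \<pi> \<Otimes>\<^sub>M data_lebesgue n)"
  using model n by (simp add: statistical_model_def cong: measurable_cong_sets sets_pair_measure_cong add: sets_prior)

lemma p_data_measurable: "\<xi> \<in> \<Theta> \<Longrightarrow> p n \<xi> \<in> borel_measurable (data_lebesgue n)"
  using measurable_compose[OF measurable_Pair1' p_pair_measurable] by (simp add: space_prior)

lemma p_nonneg: "\<xi> \<in> \<Theta> \<Longrightarrow> x \<in> space (data_lebesgue n) \<Longrightarrow> 0 \<le> p n \<xi> x"
  using model n by (simp add: statistical_model_def)

lemma law_prob: "\<xi> \<in> \<Theta> \<Longrightarrow> prob_space (law p n \<xi>)"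
  using model n by (simp add: statistical_model_def)

lemma p_integral: "\<xi> \<in> \<Theta> \<Longrightarrow> (\<integral>\<^sup>+x. ennreal (p n \<xi> x) \<partial>data_lebesgue n) = 1"
  using prob_space.emeasure_space_1[OF law_prob[of \<xi>]] p_data_measurable[of \<xi>]
  by (simp add: law_def emeasure_density cong: nn_integral_cong)

lemma sigma_finite_data: "sigma_finite_measure (data_lebesgue n :: (nat \<Rightarrow> real^'d) measure)"
proof -
  interpret product_sigma_finite "\<lambda>_::nat. lborel :: (real^'d) measure" ..
  show ?thesis unfolding data_lebesgue_def by (rule sigma_finite) simp
qed

sublocale dominated_model "prior \<Theta> \<pi>" "data_lebesgue n" "p n" "p n \<xi>\<^sub>0"
proof -
  interpret prob_space "prior \<Theta> \<pi>" using prior by (simp add: prior_density_def)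
  interpret sigma_finite_measure "data_lebesgue n :: (nat \<Rightarrow> real^'d) measure" by (rule sigma_finite_data)
  show "dominated_model (prior \<Theta> \<pi>) (data_lebesgue n) (p n) (p n \<xi>\<^sub>0)"
    by unfold_locales
      (use p_pair_measurable p_data_measurable[OF truth] p_integral p_integral[OF truth] in \<open>auto simp: space_prior\<close>)
qed

lemma truth_eq_law: "truth = law p n \<xi>\<^sub>0"
  by (simp add: law_def)

text \<open>Where the evidence is neither zero nor infinite, the Bochner integral that normalises
  the posterior density is the evidence and the posterior is a genuine probability measure.\<close>

lemma posterior_eq:
  assumes x: "x \<in> space (data_lebesgue n)" and pos: "0 < evidence x" and fin: "evidence x < \<top>"
  shows "sets (posterior \<Theta> \<pi> p n x) = sets (param_lebesgue \<Theta>)"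
    and "u \<in> borel_measurable (param_lebesgue \<Theta>) \<Longrightarrow> (\<integral>\<^sup>+\<xi>. u \<xi> \<partial>posterior \<Theta> \<pi> p n x) = posterior_mean u x"
    and "prob_space (posterior \<Theta> \<pi> p n x)"
proof -
  let ?\<mu> = "param_lebesgue \<Theta>"
  have p [measurable]: "(\<lambda>\<xi>. p n \<xi> x) \<in> borel_measurable ?\<mu>"
    using p_param[OF x] by (simp cong: measurable_cong_sets add: sets_prior)
  have \<pi>_nonneg: "0 \<le> \<pi> \<xi>" if "\<xi> \<in> \<Theta>" for \<xi>
    using prior that by (simp add: prior_density_def)
  show sets: "sets (posterior \<Theta> \<pi> p n x) = sets ?\<mu>"
    by (simp add: posterior_def)
  define Z where "Z = enn2real (evidence x)"
  have Z: "0 < Z" "evidence x = ennreal Z"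
    using pos fin by (auto simp: Z_def enn2real_positive_iff)
  have "evidence x = (\<integral>\<^sup>+\<xi>. ennreal (p n \<xi> x * \<pi> \<xi>) \<partial>?\<mu>)"
    unfolding evidence_def unfolding prior_def
    by (subst nn_integral_density)
      (auto intro!: nn_integral_cong simp: space_param ennreal_mult p_nonneg[OF _ x] \<pi>_nonneg mult.commute)
  then have Z_eq: "(\<integral>\<zeta>. p n \<zeta> x * \<pi> \<zeta> \<partial>?\<mu>) = Z"
    unfolding Z_def
    by (subst integral_eq_nn_integral) (auto intro!: AE_I2 simp: space_param p_nonneg[OF _ x] \<pi>_nonneg)
  have mean: "(\<integral>\<^sup>+\<xi>. u \<xi> \<partial>posterior \<Theta> \<pi> p n x) = posterior_mean u x"
    if [measurable]: "u \<in> borel_measurable ?\<mu>" for u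
  proof -
    have "(\<integral>\<^sup>+\<xi>. u \<xi> \<partial>posterior \<Theta> \<pi> p n x) = (\<integral>\<^sup>+\<xi>. ennreal (p n \<xi> x * \<pi> \<xi> / Z) * u \<xi> \<partial>?\<mu>)"
      unfolding posterior_def posterior_density_def Z_eq by (subst nn_integral_density) auto
    also have "\<dots> = (\<integral>\<^sup>+\<xi>. (ennreal (\<pi> \<xi>) * (u \<xi> * ennreal (p n \<xi> x))) * inverse (evidence x) \<partial>?\<mu>)"
    proof (rule nn_integral_cong)
      fix \<xi> assume "\<xi> \<in> space ?\<mu>"
      then have "0 \<le> p n \<xi> x" "0 \<le> \<pi> \<xi>"
        using p_nonneg[OF _ x] \<pi>_nonneg by (auto simp: space_param)
      then have "ennreal (p n \<xi> x * \<pi> \<xi> / Z) = ennreal (p n \<xi> x) * ennreal (\<pi> \<xi>) * inverse (evidence x)"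
        using Z by (simp add: inverse_ennreal ennreal_mult[symmetric] divide_inverse)
      then show "ennreal (p n \<xi> x * \<pi> \<xi> / Z) * u \<xi>
          = (ennreal (\<pi> \<xi>) * (u \<xi> * ennreal (p n \<xi> x))) * inverse (evidence x)"
        by (simp add: mult_ac)
    qed
    also have "\<dots> = posterior_mean u x"
      unfolding posterior_mean_def divide_ennreal_def unfolding prior_def
      by (subst nn_integral_multc) (auto simp: nn_integral_density)
    finally show ?thesis .
  qed
  then show "u \<in> borel_measurable ?\<mu> \<Longrightarrow> (\<integral>\<^sup>+\<xi>. u \<xi> \<partial>posterior \<Theta> \<pi> p n x) = posterior_mean u x" .
  have "emeasure (posterior \<Theta> \<pi> p n x) (space (posterior \<Theta> \<pi> p n x)) = posterior_mean (\<lambda>_. 1) x"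
    using mean[of "\<lambda>_. 1"] by simp
  also have "\<dots> = evidence x / evidence x"
    by (simp add: posterior_mean_def evidence_def)
  also have "\<dots> = 1" using Z by (simp add: divide_ennreal)
  finally show "prob_space (posterior \<Theta> \<pi> p n x)" by (rule prob_spaceI)
qed

text \<open>The set of the prior-mass condition is measurable, since \<open>measure\<close> is zero on non-measurable sets
  whereas the condition bounds the mass of this set from below by a positive number.\<close>

lemma prior_mass_set:
  assumes mass: "prior_mass_condition \<Theta> \<pi> p \<xi>\<^sub>0 \<epsilon> C\<^sub>2 C\<^sub>3 \<kappa>" and \<kappa>: "0 < \<kappa>"
  obtains A where "A \<in> sets (prior \<Theta> \<pi>)"
    and "ennreal (exp (- real n * C\<^sub>2 * (\<epsilon> n)\<^sup>2)) \<le> emeasure (prior \<Theta> \<pi>) A"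
    and "\<And>\<xi>. \<xi> \<in> A \<Longrightarrow> (\<integral>\<^sup>+x. ratio_power \<kappa> \<xi> x \<partial>truth) \<le> ennreal (exp (\<kappa> * (C\<^sub>3 * real n * (\<epsilon> n)\<^sup>2)))"
proof
  let ?A = "{\<xi>\<in>\<Theta>. renyi_divergence (1 + \<kappa>) (law p n \<xi>\<^sub>0) (law p n \<xi>) \<le> ereal (C\<^sub>3 * real n * (\<epsilon> n)^2)}"
  have mass': "exp (- real n * C\<^sub>2 * (\<epsilon> n)\<^sup>2) \<le> measure (prior \<Theta> \<pi>) ?A"
    using mass n by (auto simp: prior_mass_condition_def)
  show "?A \<in> sets (prior \<Theta> \<pi>)"
  proof (rule ccontr)
    assume "?A \<notin> sets (prior \<Theta> \<pi>)"
    then have "measure (prior \<Theta> \<pi>) ?A = 0" by (simp add: measure_notin_sets)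
    then show False using mass' by (metis exp_gt_zero not_le)
  qed
  show "ennreal (exp (- real n * C\<^sub>2 * (\<epsilon> n)\<^sup>2)) \<le> emeasure (prior \<Theta> \<pi>) ?A"
    using mass' by (simp add: Par.emeasure_eq_measure ennreal_leI)
  show "(\<integral>\<^sup>+x. ratio_power \<kappa> \<xi> x \<partial>truth) \<le> ennreal (exp (\<kappa> * (C\<^sub>3 * real n * (\<epsilon> n)\<^sup>2)))"
    if "\<xi> \<in> ?A" for \<xi>
    unfolding ratio_power_def
    using that law_prob[of \<xi>]
    by (intro renyi_divergence_le_imp p_data_measurable truth sigma_finite_data \<kappa>) (auto simp: law_def)
qed

text \<open>The test and sieve conditions are used at the radii \<open>e = \<epsilon> n * sqrt (k + 2)\<close>. The offset keeps every radius
  strictly above \<open>\<epsilon> n\<close>, and the squares are equally spaced, which makes the layers of the majorant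
  equally thick.\<close>

lemma loss_posterior_mean_le:
  fixes h :: "real^'p \<Rightarrow> real^'q \<Rightarrow> real"
  assumes test: "test_condition \<Theta> p \<xi>\<^sub>0 \<epsilon> C C\<^sub>0 C\<^sub>1 (sup_loss \<X> h) S"
    and sieve: "sieve_mass_condition \<Theta> \<pi> \<epsilon> C S"
    and mass: "prior_mass_condition \<Theta> \<pi> p \<xi>\<^sub>0 \<epsilon> C\<^sub>2 C\<^sub>3 \<kappa>"
    and \<epsilon>: "0 < \<epsilon> n" "1 \<le> real n * (\<epsilon> n)\<^sup>2"
    and constants: "0 < C\<^sub>0" "0 < C\<^sub>1" "0 < C\<^sub>2" "0 < C\<^sub>3" "0 < \<kappa>" "C\<^sub>2 + C\<^sub>3 + 2 < C"
  obtains F where "F \<in> borel_measurable (param_lebesgue \<Theta>)"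
    and "\<And>x \<xi>. x \<in> \<X> \<Longrightarrow> \<xi> \<in> \<Theta> \<Longrightarrow> ennreal \<bar>h x \<xi> - h x \<xi>\<^sub>0\<bar> \<le> F \<xi>"
    and "(\<integral>\<^sup>+x. posterior_mean F x \<partial>truth) \<le> ennreal (C\<^sub>1 * (2 + (\<Sum>k. tail_bound C C\<^sub>0 \<kappa> k)) * (\<epsilon> n)\<^sup>2)"
proof -
  define E where "E = real n * (\<epsilon> n)\<^sup>2"
  have E: "1 \<le> E" using \<epsilon> by (simp add: E_def)
  have C: "0 < C" using constants by linarith
  obtain A where A: "A \<in> sets (prior \<Theta> \<pi>)"
    and A_mass: "ennreal (exp (- real n * C\<^sub>2 * (\<epsilon> n)\<^sup>2)) \<le> emeasure (prior \<Theta> \<pi>) A"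
    and A_div: "\<And>\<xi>. \<xi> \<in> A \<Longrightarrow> (\<integral>\<^sup>+x. ratio_power \<kappa> \<xi> x \<partial>truth) \<le> ennreal (exp (\<kappa> * (C\<^sub>3 * real n * (\<epsilon> n)\<^sup>2)))"
    using prior_mass_set[OF mass \<open>0 < \<kappa>\<close>] by blast
  have A_pos: "0 < emeasure (prior \<Theta> \<pi>) A"
    by (rule less_le_trans[OF _ A_mass]) simp
  have "\<exists>B. B \<in> sets (prior \<Theta> \<pi>) \<and>
      (\<forall>\<xi>\<in>\<Theta>. ennreal (C\<^sub>1 * (E * real (k + 2))) \<le> sup_loss \<X> h n \<xi> \<xi>\<^sub>0 \<longrightarrow> \<xi> \<in> B) \<and>
      (\<integral>\<^sup>+x. posterior_mean (indicator B) x \<partial>truth) \<le> ennreal (tail_bound C C\<^sub>0 \<kappa> k)" for k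
  proof -
    define e where "e = \<epsilon> n * sqrt (real (k + 2))"
    have e: "\<epsilon> n < e"
    proof -
      have "\<epsilon> n * 1 < \<epsilon> n * sqrt (real (k + 2))"
        using \<epsilon> by (intro mult_strict_left_mono) auto
      then show ?thesis by (simp add: e_def)
    qed
    define t where "t = E * real (k + 2)"
    have t: "real n * e\<^sup>2 = t" by (simp add: e_def t_def E_def power_mult_distrib)
    have t_ge: "real (k + 2) \<le> t" and E_le_t: "E \<le> t"
      using E mult_right_mono[of 1 E "real (k + 2)"] mult_left_mono[of 1 "real (k + 2)" E] by (auto simp: t_def)
    have exponents: "- C * real n * e\<^sup>2 = - (C * t)" "C\<^sub>1 * real n * e\<^sup>2 = C\<^sub>1 * t"
      using t by (simp_all add: mult.assoc)
    obtain \<phi> where \<phi>: "\<phi> \<in> borel_measurable (data_lebesgue n)"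
      and \<phi>_range: "\<And>x. x \<in> space (data_lebesgue n) \<Longrightarrow> 0 \<le> \<phi> x \<and> \<phi> x \<le> 1"
      and \<phi>_0: "(\<integral>x. \<phi> x \<partial>law p n \<xi>\<^sub>0) \<le> C\<^sub>0 * exp (- (C * t))"
      and \<phi>_1: "(SUP \<xi>\<in>{\<xi>\<in>S n e. sup_loss \<X> h n \<xi> \<xi>\<^sub>0 \<ge> ennreal (C\<^sub>1 * t)}.
              ereal (\<integral>x. 1 - \<phi> x \<partial>law p n \<xi>)) \<le> ereal (exp (- (C * t)))"
      and S: "S n e \<subseteq> \<Theta>" "S n e \<in> sets (param_lebesgue \<Theta>)"
      using test e n unfolding test_condition_def exponents[symmetric] by blast
    have S_mass: "measure (prior \<Theta> \<pi>) (\<Theta> - S n e) \<le> exp (- (C * t))"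
      using sieve e n unfolding sieve_mass_condition_def exponents[symmetric] by blast
    have bounded_integral: "(\<integral>\<^sup>+x. ennreal (\<psi> x) \<partial>law p n \<xi>) = ennreal (\<integral>x. \<psi> x \<partial>law p n \<xi>)"
      if [measurable]: "\<psi> \<in> borel_measurable (data_lebesgue n)" and \<xi>: "\<xi> \<in> \<Theta>"
        and \<psi>: "\<And>x. x \<in> space (data_lebesgue n) \<Longrightarrow> 0 \<le> \<psi> x \<and> \<psi> x \<le> 1" for \<psi> \<xi>
    proof -
      interpret L: prob_space "law p n \<xi>" by (rule law_prob[OF \<xi>])
      have "AE x in law p n \<xi>. 0 \<le> \<psi> x \<and> norm (\<psi> x) \<le> 1"
        using \<psi> by (intro AE_I2) (auto simp: law_def)
      then show ?thesis
        by (intro nn_integral_eq_integral L.integrable_const_bound[where B=1]) (auto simp: law_def elim: eventually_mono)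
    qed
    obtain B where B: "B \<in> sets (prior \<Theta> \<pi>)" "\<Theta> - S n e \<subseteq> B"
      and B_test: "\<And>\<xi>. \<xi> \<in> S n e \<Longrightarrow> (\<integral>\<^sup>+x. ennreal (1 - \<phi> x) * ennreal (p n \<xi> x) \<partial>data_lebesgue n)
          \<le> ennreal (exp (- (C * t))) \<Longrightarrow> \<xi> \<in> B"
      and B_post: "(\<integral>\<^sup>+x. posterior_mean (indicator B) x \<partial>truth)
        \<le> (\<integral>\<^sup>+x. ennreal (\<phi> x) \<partial>truth) + ennreal (exp (- \<kappa> * t))
          + ennreal (exp (C\<^sub>3 * real n * (\<epsilon> n)\<^sup>2 + t)) / emeasure (prior \<Theta> \<pi>) A
            * (ennreal (exp (- (C * t))) + ennreal (exp (- (C * t))))"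
    proof (rule posterior_tail_prob_le[OF A \<open>0 < \<kappa>\<close> A_pos A_div _ _ \<phi> \<phi>_range, where t = t])
      show "S n e \<in> sets (prior \<Theta> \<pi>)" using S by (simp add: sets_prior)
      show "emeasure (prior \<Theta> \<pi>) (space (prior \<Theta> \<pi>) - S n e) \<le> ennreal (exp (- (C * t)))"
        using S_mass by (simp add: space_prior Par.emeasure_eq_measure ennreal_leI)
    qed (auto simp: space_prior)
    have large_loss: "\<xi> \<in> B" if \<xi>: "\<xi> \<in> \<Theta>" "ennreal (C\<^sub>1 * t) \<le> sup_loss \<X> h n \<xi> \<xi>\<^sub>0" for \<xi>
    proof (cases "\<xi> \<in> S n e")
      case True
      have [measurable]: "p n \<xi> \<in> borel_measurable (data_lebesgue n)" by (rule p_data_measurable[OF \<xi>(1)])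
      note [measurable] = \<phi>
      have "ereal (\<integral>x. 1 - \<phi> x \<partial>law p n \<xi>) \<le> ereal (exp (- (C * t)))"
        by (rule order_trans[OF SUP_upper \<phi>_1]) (use True \<xi> in simp)
      moreover have "(\<integral>\<^sup>+x. ennreal (1 - \<phi> x) * ennreal (p n \<xi> x) \<partial>data_lebesgue n)
          = (\<integral>\<^sup>+x. ennreal (1 - \<phi> x) \<partial>law p n \<xi>)"
        unfolding law_def by (subst nn_integral_density) (auto simp: mult.commute)
      moreover have "\<dots> = ennreal (\<integral>x. 1 - \<phi> x \<partial>law p n \<xi>)"
        using \<phi>_range \<xi> by (intro bounded_integral) auto
      ultimately show ?thesis using True by (intro B_test) (auto intro: ennreal_leI)
    qed (use B \<xi> in auto)
    have evidence_term: "ennreal (exp (C\<^sub>3 * real n * (\<epsilon> n)\<^sup>2 + t)) / emeasure (prior \<Theta> \<pi>) A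
        * (ennreal (exp (- (C * t))) + ennreal (exp (- (C * t)))) \<le> ennreal (2 * exp (- real (k + 2)))"
    proof -
      have "ennreal (exp (C\<^sub>3 * real n * (\<epsilon> n)\<^sup>2 + t)) / emeasure (prior \<Theta> \<pi>) A \<le> ennreal (exp (C\<^sub>3 * E + t + C\<^sub>2 * E))"
      proof (rule divide_le_posI_ennreal[OF A_pos])
        have "ennreal (exp (C\<^sub>3 * real n * (\<epsilon> n)\<^sup>2 + t))
            = ennreal (exp (- real n * C\<^sub>2 * (\<epsilon> n)\<^sup>2)) * ennreal (exp (C\<^sub>3 * E + t + C\<^sub>2 * E))"
          by (simp add: ennreal_mult[symmetric] exp_add[symmetric] E_def algebra_simps)
        also have "\<dots> \<le> emeasure (prior \<Theta> \<pi>) A * ennreal (exp (C\<^sub>3 * E + t + C\<^sub>2 * E))"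
          by (intro mult_right_mono A_mass) simp
        finally show "ennreal (exp (C\<^sub>3 * real n * (\<epsilon> n)\<^sup>2 + t)) \<le> \<dots>" .
      qed
      \<comment> \<open>The two copies of the error bound cost a factor \<open>2\<close>; the gap \<open>C > C\<^sub>2 + C\<^sub>3 + 2\<close> absorbs the inverse
        of the evidence bound and leaves a factor of at most \<open>exp (- t)\<close>.\<close>
      then have "ennreal (exp (C\<^sub>3 * real n * (\<epsilon> n)\<^sup>2 + t)) / emeasure (prior \<Theta> \<pi>) A
          * (ennreal (exp (- (C * t))) + ennreal (exp (- (C * t))))
          \<le> ennreal (exp (C\<^sub>3 * E + t + C\<^sub>2 * E)) * (ennreal (exp (- (C * t))) + ennreal (exp (- (C * t))))"
        by (intro mult_right_mono) auto
      also have "\<dots> = ennreal (2 * exp (C\<^sub>3 * E + t + C\<^sub>2 * E - C * t))"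
        by (simp add: ennreal_plus[symmetric] ennreal_mult[symmetric] exp_add exp_diff exp_minus field_simps del: ennreal_plus)
      also have "\<dots> \<le> ennreal (2 * exp (- real (k + 2)))"
      proof -
        have "C\<^sub>3 * E \<le> C\<^sub>3 * t" "C\<^sub>2 * E \<le> C\<^sub>2 * t"
          using constants E_le_t by (auto intro: mult_left_mono)
        moreover have "(C\<^sub>2 + C\<^sub>3 + 2) * t \<le> C * t"
          using constants t_ge by (intro mult_right_mono) auto
        ultimately have "C\<^sub>3 * E + t + C\<^sub>2 * E - C * t \<le> - real (k + 2)"
          using t_ge by (simp add: algebra_simps)
        then show ?thesis by (intro ennreal_leI) simp
      qed
      finally show ?thesis .
    qed
    have test_term: "(\<integral>\<^sup>+x. ennreal (\<phi> x) \<partial>truth) \<le> ennreal (C\<^sub>0 * exp (- C * real (k + 2)))"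
    proof -
      have "(\<integral>\<^sup>+x. ennreal (\<phi> x) \<partial>truth) \<le> ennreal (C\<^sub>0 * exp (- (C * t)))"
        using bounded_integral[OF \<phi> truth \<phi>_range] \<phi>_0 by (simp add: truth_eq_law ennreal_leI)
      also have "\<dots> \<le> ennreal (C\<^sub>0 * exp (- C * real (k + 2)))"
        using constants C t_ge by (intro ennreal_leI mult_left_mono) auto
      finally show ?thesis .
    qed
    have renyi_term: "ennreal (exp (- \<kappa> * t)) \<le> ennreal (exp (- \<kappa> * real (k + 2)))"
      using constants t_ge by (intro ennreal_leI) auto
    have "(\<integral>\<^sup>+x. posterior_mean (indicator B) x \<partial>truth) \<le> ennreal (C\<^sub>0 * exp (- C * real (k + 2)))
        + ennreal (exp (- \<kappa> * real (k + 2))) + ennreal (2 * exp (- real (k + 2)))"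
      by (rule order_trans[OF B_post add_mono[OF add_mono[OF test_term renyi_term] evidence_term]])
    also have "\<dots> = ennreal (tail_bound C C\<^sub>0 \<kappa> k)"
      unfolding tail_bound_def using constants by (simp add: ennreal_plus[symmetric] del: ennreal_plus)
    finally show ?thesis using B large_loss by (auto simp: t_def)
  qed
  then obtain B where B: "\<And>k. B k \<in> sets (prior \<Theta> \<pi>)"
    and B_loss: "\<And>k \<xi>. \<xi> \<in> \<Theta> \<Longrightarrow> ennreal (C\<^sub>1 * (E * real (k + 2))) \<le> sup_loss \<X> h n \<xi> \<xi>\<^sub>0 \<Longrightarrow> \<xi> \<in> B k"
    and B_post: "\<And>k. (\<integral>\<^sup>+x. posterior_mean (indicator (B k)) x \<partial>truth) \<le> ennreal (tail_bound C C\<^sub>0 \<kappa> k)"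
    by metis
  let ?c = "C\<^sub>1 * (\<epsilon> n)\<^sup>2"
  have c: "0 < ?c" using constants \<epsilon> by simp
  let ?F = "\<lambda>\<xi>. ennreal ?c * (2 + (\<Sum>k. indicator (B k) \<xi>))"
  show thesis
  proof (rule that[of ?F])
    have [measurable]: "B k \<in> sets (param_lebesgue \<Theta>)" for k using B by (simp add: sets_prior)
    show "?F \<in> borel_measurable (param_lebesgue \<Theta>)" by measurable
    show "(\<integral>\<^sup>+x. posterior_mean ?F x \<partial>truth) \<le> ennreal (C\<^sub>1 * (2 + (\<Sum>k. tail_bound C C\<^sub>0 \<kappa> k)) * (\<epsilon> n)\<^sup>2)"
      using posterior_mean_layer_cake[OF B B_post tail_bound_nonneg summable_tail_bound[OF C \<open>0 < \<kappa>\<close>], of ?c] c constants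
      by (simp add: mult_ac)
    show "ennreal \<bar>h x \<xi> - h x \<xi>\<^sub>0\<bar> \<le> ?F \<xi>" if x: "x \<in> \<X>" and \<xi>: "\<xi> \<in> \<Theta>" for x \<xi>
    proof (rule le_layer_cake[OF c])
      fix k assume "\<xi> \<notin> B k"
      then have "sup_loss \<X> h n \<xi> \<xi>\<^sub>0 < ennreal (C\<^sub>1 * (E * real (k + 2)))"
        using B_loss[OF \<xi>] by (meson not_le)
      moreover have "ennreal (real n) * ennreal \<bar>h x \<xi> - h x \<xi>\<^sub>0\<bar> \<le> sup_loss \<X> h n \<xi> \<xi>\<^sub>0"
        unfolding sup_loss_def ennreal_of_nat_eq_real_of_nat using x by (intro mult_left_mono SUP_upper) auto
      moreover have "ennreal (C\<^sub>1 * (E * real (k + 2))) = ennreal (real n) * ennreal (?c * real (k + 2))"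
        using constants \<epsilon> by (subst ennreal_mult[symmetric]) (auto simp: E_def mult_ac)
      ultimately have "ennreal (real n) * ennreal \<bar>h x \<xi> - h x \<xi>\<^sub>0\<bar> \<le> ennreal (real n) * ennreal (?c * real (k + 2))"
        by simp
      then show "ennreal \<bar>h x \<xi> - h x \<xi>\<^sub>0\<bar> \<le> ennreal (?c * real (k + 2))"
        using n by (subst (asm) ennreal_mult_le_mult_iff) auto
    qed
  qed
qed

section \<open>Deviation of the Bayesian optimal value\<close>

lemma posterior_mean_markov:
  assumes u: "u \<in> borel_measurable (param_lebesgue \<Theta>)" and m: "0 < m"
    and le: "(\<integral>\<^sup>+x. posterior_mean u x \<partial>truth) \<le> ennreal K" and K: "0 \<le> K"
  shows "emeasure truth {x \<in> space (data_lebesgue n). ennreal m \<le> posterior_mean u x} \<le> ennreal (K / m)"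
proof -
  have u': "u \<in> borel_measurable (prior \<Theta> \<pi>)"
    using u by (simp cong: measurable_cong_sets add: sets_prior)
  note [measurable] = posterior_mean_measurable[OF u']
  have "{x \<in> space (data_lebesgue n). ennreal m \<le> posterior_mean u x}
      = {x \<in> space truth. 1 \<le> ennreal (1 / m) * posterior_mean u x}"
  proof -
    have "ennreal m \<le> y \<longleftrightarrow> 1 \<le> ennreal (1 / m) * y" for y
    proof -
      have "ennreal (1 / m) * ennreal m = 1" using m by (simp add: ennreal_mult[symmetric])
      then show ?thesis
        using m ennreal_mult_le_mult_iff[of "ennreal (1 / m)" "ennreal m" y] by simp
    qed
    then show ?thesis by simp
  qed
  then have "emeasure truth {x \<in> space (data_lebesgue n). ennreal m \<le> posterior_mean u x}
      \<le> ennreal (1 / m) * (\<integral>\<^sup>+x. posterior_mean u x * indicator (space truth) x \<partial>truth)"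
    using nn_integral_Markov_inequality[of "posterior_mean u" "space truth" truth "ennreal (1 / m)"] by simp
  also have "(\<integral>\<^sup>+x. posterior_mean u x * indicator (space truth) x \<partial>truth) = (\<integral>\<^sup>+x. posterior_mean u x \<partial>truth)"
    by (intro nn_integral_cong) (simp add: indicator_def)
  also have "ennreal (1 / m) * \<dots> \<le> ennreal (1 / m) * ennreal K" by (intro mult_left_mono le) simp
  also have "\<dots> = ennreal (K / m)" using m K by (simp add: ennreal_mult[symmetric])
  finally show ?thesis .
qed

text \<open>The deviation event is not known to be measurable. It is covered by a null set, on which the posterior may be
  degenerate, and two measurable events to which Markov's inequality applies.\<close>

lemma bayes_optimal_value_deviation:
  fixes f g :: "real^'p \<Rightarrow> real^'q \<Rightarrow> real"
  assumes f: "\<And>x. x \<in> \<X> \<Longrightarrow> f x \<in> borel_measurable (param_lebesgue \<Theta>)"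
    and g: "\<And>x. x \<in> \<X> \<Longrightarrow> g x \<in> borel_measurable (param_lebesgue \<Theta>)"
    and sol: "has_solution \<X> f g \<xi>\<^sub>0" and \<beta>: "\<beta> < 1"
    and F: "F \<in> borel_measurable (param_lebesgue \<Theta>)"
      "\<And>x \<xi>. x \<in> \<X> \<Longrightarrow> \<xi> \<in> \<Theta> \<Longrightarrow> ennreal \<bar>f x \<xi> - f x \<xi>\<^sub>0\<bar> \<le> F \<xi>"
      "(\<integral>\<^sup>+x. posterior_mean F x \<partial>truth) \<le> ennreal K"
    and G: "G \<in> borel_measurable (param_lebesgue \<Theta>)"
      "\<And>x \<xi>. x \<in> \<X> \<Longrightarrow> \<xi> \<in> \<Theta> \<Longrightarrow> ennreal \<bar>indicator {..0} (g x \<xi>) - indicator {..0} (g x \<xi>\<^sub>0)\<bar> \<le> G \<xi>"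
      "(\<integral>\<^sup>+x. posterior_mean G x \<partial>truth) \<le> ennreal K"
    and K: "0 \<le> K" and pos: "AE x in truth. 0 < evidence x"
    and \<eta>: "0 < \<eta>" and \<delta>: "0 < \<delta>" "\<delta> < \<beta>"
  shows "outer_measure_of (law p n \<xi>\<^sub>0)
      {X \<in> space (law p n \<xi>\<^sub>0).
        \<bar>bayes_optimal_value \<X> f g \<beta> \<Theta> \<pi> p n X - optimal_value \<X> f g \<xi>\<^sub>0\<bar> > ereal (2 * \<eta>)}
    \<le> ennreal (K / min \<delta> (1 - \<beta>) + K / \<eta>)"
proof -
  define m where "m = min \<delta> (1 - \<beta>)"
  have m: "0 < m" "m < \<beta>" "m \<le> 1 - \<beta>" using \<delta> \<beta> by (auto simp: m_def)
  let ?bad = "{X \<in> space (law p n \<xi>\<^sub>0).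
        \<bar>bayes_optimal_value \<X> f g \<beta> \<Theta> \<pi> p n X - optimal_value \<X> f g \<xi>\<^sub>0\<bar> > ereal (2 * \<eta>)}"
  let ?WG = "{x \<in> space (data_lebesgue n). ennreal m \<le> posterior_mean G x}"
  let ?WF = "{x \<in> space (data_lebesgue n). ennreal \<eta> \<le> posterior_mean F x}"
  have "AE x in truth. 0 < evidence x \<and> evidence x < \<top>"
    using pos evidence_finite by eventually_elim simp
  then obtain N where N: "\<And>x. x \<in> space truth - N \<Longrightarrow> 0 < evidence x \<and> evidence x < \<top>"
      "N \<in> null_sets truth"
    by (rule AE_E3) blast
  have F': "F \<in> borel_measurable (prior \<Theta> \<pi>)" and G': "G \<in> borel_measurable (prior \<Theta> \<pi>)"
    using F(1) G(1) by (simp_all cong: measurable_cong_sets add: sets_prior)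
  note [measurable] = posterior_mean_measurable[OF F'] posterior_mean_measurable[OF G']
  have meas: "?WG \<in> sets truth" "?WF \<in> sets truth" by simp_all
  have bad: "?bad \<subseteq> (?WG \<union> ?WF) \<union> N"
  proof (rule subsetI, rule ccontr)
    fix X assume X: "X \<in> ?bad" and out: "X \<notin> (?WG \<union> ?WF) \<union> N"
    have sp: "X \<in> space (data_lebesgue n)" using X by (simp add: law_def)
    have ev: "0 < evidence X" "evidence X < \<top>" using N(1)[of X] sp out by auto
    note post = posterior_eq[OF sp ev]
    have space: "space (posterior \<Theta> \<pi> p n X) = \<Theta>"
      using sets_eq_imp_space_eq[OF post(1)] by (simp add: space_param)
    have FX: "(\<integral>\<^sup>+\<xi>. F \<xi> \<partial>posterior \<Theta> \<pi> p n X) \<le> ennreal \<eta>"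
      and GX: "(\<integral>\<^sup>+\<xi>. G \<xi> \<partial>posterior \<Theta> \<pi> p n X) < ennreal m"
      using out sp by (auto simp: post(2)[OF F(1)] post(2)[OF G(1)] not_le)
    have "\<bar>(INF x\<in>{x\<in>\<X>. \<beta> \<le> measure (posterior \<Theta> \<pi> p n X) {\<xi>\<in>space (posterior \<Theta> \<pi> p n X). g x \<xi> \<le> 0}}.
        ereal (\<integral>\<xi>. f x \<xi> \<partial>posterior \<Theta> \<pi> p n X)) - optimal_value \<X> f g \<xi>\<^sub>0\<bar> \<le> ereal \<eta>"
    proof (rule optimal_value_stable[OF post(3) _ _ _ FX _ _ _ _ _ sol])
      show "(\<integral>\<^sup>+\<xi>. G \<xi> \<partial>posterior \<Theta> \<pi> p n X) \<le> ennreal (1 - \<beta>)"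
        "(\<integral>\<^sup>+\<xi>. G \<xi> \<partial>posterior \<Theta> \<pi> p n X) < ennreal \<beta>"
        using GX m by (auto intro: order.strict_implies_order order.strict_trans2 ennreal_leI)
    qed (use f g F(2) G(2) \<eta> \<beta> in \<open>auto simp: space cong: measurable_cong_sets simp: post(1)\<close>)
    then have "\<bar>bayes_optimal_value \<X> f g \<beta> \<Theta> \<pi> p n X - optimal_value \<X> f g \<xi>\<^sub>0\<bar> \<le> ereal \<eta>"
      unfolding space bayes_optimal_value_def .
    also have "\<dots> < ereal (2 * \<eta>)" using \<eta> by simp
    finally show False using X by auto
  qed
  have W: "(?WG \<union> ?WF) \<union> N \<in> sets truth"
    by (intro sets.Un meas null_setsD2 N(2))
  have "outer_measure_of (law p n \<xi>\<^sub>0) ?bad \<le> emeasure (law p n \<xi>\<^sub>0) ((?WG \<union> ?WF) \<union> N)"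
    unfolding outer_measure_of_def
    by (intro INF_lower CollectI conjI bad W[unfolded truth_eq_law])
  also have "\<dots> = emeasure truth ((?WG \<union> ?WF) \<union> N)" by (simp only: truth_eq_law)
  also have "\<dots> = emeasure truth (?WG \<union> ?WF)" by (intro emeasure_Un_null_set sets.Un meas N(2))
  also have "\<dots> \<le> emeasure truth ?WG + emeasure truth ?WF" by (intro emeasure_subadditive meas)
  also have "\<dots> \<le> ennreal (K / m) + ennreal (K / \<eta>)"
    using posterior_mean_markov[OF G(1) m(1) G(3) K] posterior_mean_markov[OF F(1) \<eta> F(3) K]
    by (rule add_mono)
  also have "\<dots> = ennreal (K / m + K / \<eta>)"
    using K m \<eta> by (simp add: ennreal_plus[symmetric] del: ennreal_plus)
  finally show ?thesis by (simp add: m_def)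
qed

end

theorem corollary4p2:
  fixes \<X> :: "(real^'p) set" and \<Theta> :: "(real^'q) set" and \<xi>\<^sub>0 :: "real^'q"
    and f g :: "real^'p \<Rightarrow> real^'q \<Rightarrow> real"
    and p :: "nat \<Rightarrow> real^'q \<Rightarrow> (nat \<Rightarrow> real^'d) \<Rightarrow> real"
    and \<pi> :: "real^'q \<Rightarrow> real"
    and \<epsilon> :: "nat \<Rightarrow> real"
    and \<beta> C C\<^sub>0 C\<^sub>1 C\<^sub>2 C\<^sub>3 \<kappa> :: real
    and S\<^sub>1 S\<^sub>2 :: "nat \<Rightarrow> real \<Rightarrow> (real^'q) set"
  assumes "convex \<X>" and "compact \<X>"
    and "\<Theta> \<in> sets borel" and "\<xi>\<^sub>0 \<in> \<Theta>"
    and "statistical_model \<Theta> p" and "prior_density \<Theta> \<pi>"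
    and "\<And>x. x \<in> \<X> \<Longrightarrow> f x \<in> borel_measurable (param_lebesgue \<Theta>)"
    and "\<And>x. x \<in> \<X> \<Longrightarrow> g x \<in> borel_measurable (param_lebesgue \<Theta>)"
    and "AE \<xi> in prior \<Theta> \<pi>. continuous_on \<X> (\<lambda>x. f x \<xi>) \<and> continuous_on \<X> (\<lambda>x. g x \<xi>)"
    and "has_solution \<X> f g \<xi>\<^sub>0"
    and "0 < \<beta>" and "\<beta> < 1"
    and "\<And>n. n \<ge> 1 \<Longrightarrow> 0 < \<epsilon> n"
    and "\<And>n. n \<ge> 1 \<Longrightarrow> real n * (\<epsilon> n)^2 \<ge> 1"
    and "(\<lambda>n. (\<epsilon> n)^2) \<longlonglongrightarrow> 0"
    and "0 < C" and "0 < C\<^sub>0" and "0 < C\<^sub>1" and "0 < C\<^sub>2" and "0 < C\<^sub>3" and "0 < \<kappa>"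
    and "C > C\<^sub>2 + C\<^sub>3 + 2"
    and "test_condition \<Theta> p \<xi>\<^sub>0 \<epsilon> C C\<^sub>0 C\<^sub>1 (constraint_loss \<X> g) S\<^sub>1"
    and "test_condition \<Theta> p \<xi>\<^sub>0 \<epsilon> C C\<^sub>0 C\<^sub>1 (sup_loss \<X> f) S\<^sub>2"
    and "sieve_mass_condition \<Theta> \<pi> \<epsilon> C S\<^sub>1"
    and "sieve_mass_condition \<Theta> \<pi> \<epsilon> C S\<^sub>2"
    and "prior_mass_condition \<Theta> \<pi> p \<xi>\<^sub>0 \<epsilon> C\<^sub>2 C\<^sub>3 \<kappa>"
  shows "\<exists>M\<^sub>1>0. \<exists>M\<^sub>2>0. \<forall>n\<ge>1. \<forall>\<eta>>0. \<forall>\<delta>. 0 < \<delta> \<and> \<delta> < \<beta> \<longrightarrow>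
           outer_measure_of (law p n \<xi>\<^sub>0)
             {X \<in> space (law p n \<xi>\<^sub>0).
                \<bar>bayes_optimal_value \<X> f g \<beta> \<Theta> \<pi> p n X - optimal_value \<X> f g \<xi>\<^sub>0\<bar> > ereal (2 * \<eta>)}
           \<le> ennreal ((M\<^sub>1 / min \<delta> (1 - \<beta>) + M\<^sub>2 / \<eta>) * (\<epsilon> n)^2)"
proof -
  define M where "M = C\<^sub>1 * (2 + (\<Sum>k. tail_bound C C\<^sub>0 \<kappa> k))"
  have "0 \<le> (\<Sum>k. tail_bound C C\<^sub>0 \<kappa> k)"
    using assms by (intro suminf_nonneg summable_tail_bound tail_bound_nonneg) auto
  then have M: "0 < M" using \<open>0 < C\<^sub>1\<close> by (simp add: M_def)
  show ?thesis
  proof (intro exI[of _ M] conjI M allI impI)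
    fix n :: nat and \<eta> \<delta> :: real
    assume n: "1 \<le> n" and \<eta>: "0 < \<eta>" and \<delta>: "0 < \<delta> \<and> \<delta> < \<beta>"
    interpret posterior_setting \<Theta> \<pi> p n \<xi>\<^sub>0
      by (rule posterior_setting.intro) (use assms n in auto)
    note \<epsilon> = assms(13)[OF n] assms(14)[OF n]
    note constants = \<open>0 < C\<^sub>0\<close> \<open>0 < C\<^sub>1\<close> \<open>0 < C\<^sub>2\<close> \<open>0 < C\<^sub>3\<close> \<open>0 < \<kappa>\<close> \<open>C > C\<^sub>2 + C\<^sub>3 + 2\<close>
    obtain G where G: "G \<in> borel_measurable (param_lebesgue \<Theta>)"
      "\<And>x \<xi>. x \<in> \<X> \<Longrightarrow> \<xi> \<in> \<Theta> \<Longrightarrow> ennreal \<bar>indicator {..0} (g x \<xi>) - indicator {..0} (g x \<xi>\<^sub>0)\<bar> \<le> G \<xi>"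
      "(\<integral>\<^sup>+x. posterior_mean G x \<partial>truth) \<le> ennreal (M * (\<epsilon> n)\<^sup>2)"
      using loss_posterior_mean_le[OF assms(23)[unfolded constraint_loss_def] assms(25) assms(27) \<epsilon> constants]
      unfolding M_def by blast
    obtain F where F: "F \<in> borel_measurable (param_lebesgue \<Theta>)"
      "\<And>x \<xi>. x \<in> \<X> \<Longrightarrow> \<xi> \<in> \<Theta> \<Longrightarrow> ennreal \<bar>f x \<xi> - f x \<xi>\<^sub>0\<bar> \<le> F \<xi>"
      "(\<integral>\<^sup>+x. posterior_mean F x \<partial>truth) \<le> ennreal (M * (\<epsilon> n)\<^sup>2)"
      using loss_posterior_mean_le[OF assms(24) assms(26) assms(27) \<epsilon> constants]
      unfolding M_def by blast
    obtain A where A: "A \<in> sets (prior \<Theta> \<pi>)"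
      "ennreal (exp (- real n * C\<^sub>2 * (\<epsilon> n)\<^sup>2)) \<le> emeasure (prior \<Theta> \<pi>) A"
      "\<And>\<xi>. \<xi> \<in> A \<Longrightarrow> (\<integral>\<^sup>+x. ratio_power \<kappa> \<xi> x \<partial>truth) \<le> ennreal (exp (\<kappa> * (C\<^sub>3 * real n * (\<epsilon> n)\<^sup>2)))"
      using prior_mass_set[OF assms(27) \<open>0 < \<kappa>\<close>] by blast
    have "0 < emeasure (prior \<Theta> \<pi>) A" by (rule less_le_trans[OF _ A(2)]) simp
    then have pos: "AE x in truth. 0 < evidence x"
      using evidence_positive[OF A(1) \<open>0 < \<kappa>\<close>] A(3) by blast
    have "(M / min \<delta> (1 - \<beta>) + M / \<eta>) * (\<epsilon> n)\<^sup>2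
        = M * (\<epsilon> n)\<^sup>2 / min \<delta> (1 - \<beta>) + M * (\<epsilon> n)\<^sup>2 / \<eta>"
      by (simp add: distrib_right)
    moreover have K: "0 \<le> M * (\<epsilon> n)\<^sup>2" using M by simp
    ultimately show "outer_measure_of (law p n \<xi>\<^sub>0)
             {X \<in> space (law p n \<xi>\<^sub>0).
                \<bar>bayes_optimal_value \<X> f g \<beta> \<Theta> \<pi> p n X - optimal_value \<X> f g \<xi>\<^sub>0\<bar> > ereal (2 * \<eta>)}
           \<le> ennreal ((M / min \<delta> (1 - \<beta>) + M / \<eta>) * (\<epsilon> n)^2)"
      using bayes_optimal_value_deviation[OF assms(7) assms(8) assms(10) assms(12) F G K pos \<eta>] \<delta>
      by (simp only:)
  qed
qed

end
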